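(* Let $R$ be a ring with unity, let $\mathcal{X}$ be a semibrick of left $R$-modules and let $f:M\to N$ be a nonzero homomorphism between two $\mathcal{X}$-semisimple modules $M$ and $N$. Then $\ker f$ and $\mathrm{coker}\,f$ are $\mathcal{X}$-semisimple.
   Context: A brick is a finitely presented left $R$-module whose endomorphism ring is a division ring. A semibrick is a class $\mathcal{X}$ of pairwise non-isomorphic bricks with $\mathrm{Hom}(X,X')=0$ for distinct $X,X'\in\mathcal{X}$. A module is $\mathcal{X}$-semisimple if it is isomorphic to a (possibly empty or infinite) direct sum of objects from $\mathcal{X}$ (repetitions allowed). *)

theory Defs
  imports "HOL-Algebra.QuotRing" "HOL-Algebra.Module"
begin

text \<open>
  The locale \<open>module\<close> of HOL-Algebra requires a commutative base ring.  Here \<open>R\<close> is an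
  arbitrary ring with unity.  As in HOL-Algebra, a module is a record that also has the fields
  \<open>mult\<close> and \<open>one\<close>; they play no role.
\<close>

locale left_module = R?: ring R + M?: abelian_group M
  for R :: "('r, 'p) ring_scheme" (structure) and M :: "('r, 'm, 'q) module_scheme" (structure) +
  assumes smult_closed [simp, intro]:
      "\<lbrakk>a \<in> carrier R; x \<in> carrier M\<rbrakk> \<Longrightarrow> a \<odot>\<^bsub>M\<^esub> x \<in> carrier M"
    and smult_l_distr:
      "\<lbrakk>a \<in> carrier R; b \<in> carrier R; x \<in> carrier M\<rbrakk> \<Longrightarrow>
        (a \<oplus>\<^bsub>R\<^esub> b) \<odot>\<^bsub>M\<^esub> x = a \<odot>\<^bsub>M\<^esub> x \<oplus>\<^bsub>M\<^esub> b \<odot>\<^bsub>M\<^esub> x"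
    and smult_r_distr:
      "\<lbrakk>a \<in> carrier R; x \<in> carrier M; y \<in> carrier M\<rbrakk> \<Longrightarrow>
        a \<odot>\<^bsub>M\<^esub> (x \<oplus>\<^bsub>M\<^esub> y) = a \<odot>\<^bsub>M\<^esub> x \<oplus>\<^bsub>M\<^esub> a \<odot>\<^bsub>M\<^esub> y"
    and smult_assoc:
      "\<lbrakk>a \<in> carrier R; b \<in> carrier R; x \<in> carrier M\<rbrakk> \<Longrightarrow>
        (a \<otimes>\<^bsub>R\<^esub> b) \<odot>\<^bsub>M\<^esub> x = a \<odot>\<^bsub>M\<^esub> (b \<odot>\<^bsub>M\<^esub> x)"
    and smult_one [simp]: "x \<in> carrier M \<Longrightarrow> \<one>\<^bsub>R\<^esub> \<odot>\<^bsub>M\<^esub> x = x"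

definition lmod_hom ::
  "('r, 'p) ring_scheme \<Rightarrow> ('r, 'm, 'q) module_scheme \<Rightarrow> ('r, 'n, 's) module_scheme \<Rightarrow> ('m \<Rightarrow> 'n) set"
  where "lmod_hom R M N =
    {h \<in> carrier M \<rightarrow> carrier N.
      (\<forall>x\<in>carrier M. \<forall>y\<in>carrier M. h (x \<oplus>\<^bsub>M\<^esub> y) = h x \<oplus>\<^bsub>N\<^esub> h y) \<and>
      (\<forall>a\<in>carrier R. \<forall>x\<in>carrier M. h (a \<odot>\<^bsub>M\<^esub> x) = a \<odot>\<^bsub>N\<^esub> h x)}"

definition lmod_isomorphic ::
  "('r, 'p) ring_scheme \<Rightarrow> ('r, 'm, 'q) module_scheme \<Rightarrow> ('r, 'n, 's) module_scheme \<Rightarrow> bool"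
  where "lmod_isomorphic R M N \<longleftrightarrow>
    (\<exists>h \<in> lmod_hom R M N. bij_betw h (carrier M) (carrier N))"

definition regular_lmod :: "('r, 'p) ring_scheme \<Rightarrow> ('r, 'r) module"
  where "regular_lmod R =
    \<lparr>carrier = carrier R, mult = mult R, one = one R, zero = zero R, add = add R, smult = mult R\<rparr>"

definition lmod_direct_sum :: "'i set \<Rightarrow> ('i \<Rightarrow> ('r, 'm, 'q) module_scheme) \<Rightarrow> ('r, 'i \<Rightarrow> 'm) module"
  where "lmod_direct_sum I F =
    \<lparr>carrier = {x \<in> (\<Pi>\<^sub>E i\<in>I. carrier (F i)). finite {i \<in> I. x i \<noteq> \<zero>\<^bsub>F i\<^esub>}},
     mult = undefined, one = undefined,
     zero = (\<lambda>i\<in>I. \<zero>\<^bsub>F i\<^esub>),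
     add = (\<lambda>x y. \<lambda>i\<in>I. x i \<oplus>\<^bsub>F i\<^esub> y i),
     smult = (\<lambda>a x. \<lambda>i\<in>I. a \<odot>\<^bsub>F i\<^esub> x i)\<rparr>"

definition lmod_kernel ::
  "('r, 'm, 'q) module_scheme \<Rightarrow> ('r, 'n, 's) module_scheme \<Rightarrow> ('m \<Rightarrow> 'n) \<Rightarrow> ('r, 'm, 'q) module_scheme"
  where "lmod_kernel M N f = M\<lparr>carrier := a_kernel M N f\<rparr>"

definition lmod_quotient :: "('r, 'n, 's) module_scheme \<Rightarrow> 'n set \<Rightarrow> ('r, 'n set) module"
  where "lmod_quotient N K =
    \<lparr>carrier = a_rcosets\<^bsub>N\<^esub> K, mult = undefined, one = undefined,
     zero = K, add = set_add N, smult = (\<lambda>a C. \<Union>x\<in>C. K +>\<^bsub>N\<^esub> (a \<odot>\<^bsub>N\<^esub> x))\<rparr>"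

definition lmod_coker ::
  "('r, 'm, 'q) module_scheme \<Rightarrow> ('r, 'n, 's) module_scheme \<Rightarrow> ('m \<Rightarrow> 'n) \<Rightarrow> ('r, 'n set) module"
  where "lmod_coker M N f = lmod_quotient N (f ` carrier M)"

text \<open>Finite presentation: an exact sequence \<open>R\<^sup>m \<rightarrow> R\<^sup>n \<rightarrow> M \<rightarrow> 0\<close>.\<close>

definition finitely_presented :: "('r, 'p) ring_scheme \<Rightarrow> ('r, 'm, 'q) module_scheme \<Rightarrow> bool"
  where "finitely_presented R M \<longleftrightarrow> left_module R M \<and>
    (\<exists>(m::nat) (n::nat) g p.
      g \<in> lmod_hom R (lmod_direct_sum {..<m} (\<lambda>_. regular_lmod R))
                     (lmod_direct_sum {..<n} (\<lambda>_. regular_lmod R)) \<and>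
      p \<in> lmod_hom R (lmod_direct_sum {..<n} (\<lambda>_. regular_lmod R)) M \<and>
      g ` carrier (lmod_direct_sum {..<m} (\<lambda>_. regular_lmod R)) =
        a_kernel (lmod_direct_sum {..<n} (\<lambda>_. regular_lmod R)) M p \<and>
      p ` carrier (lmod_direct_sum {..<n} (\<lambda>_. regular_lmod R)) = carrier M)"

text \<open>Endomorphisms are made extensional so that equality in the ring is equality of maps.\<close>

definition lmod_End :: "('r, 'p) ring_scheme \<Rightarrow> ('r, 'm, 'q) module_scheme \<Rightarrow> ('m \<Rightarrow> 'm) ring"
  where "lmod_End R M =
    \<lparr>carrier = lmod_hom R M M \<inter> extensional (carrier M),
     mult = compose (carrier M),
     one = (\<lambda>x\<in>carrier M. x),
     zero = (\<lambda>x\<in>carrier M. \<zero>\<^bsub>M\<^esub>),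
     add = (\<lambda>g h. \<lambda>x\<in>carrier M. g x \<oplus>\<^bsub>M\<^esub> h x)\<rparr>"

locale div_ring = ring D for D (structure) +
  assumes one_not_zero: "\<one> \<noteq> \<zero>"
    and Units_eq: "Units D = carrier D - {\<zero>}"

definition brick :: "('r, 'p) ring_scheme \<Rightarrow> ('r, 'm, 'q) module_scheme \<Rightarrow> bool"
  where "brick R M \<longleftrightarrow> finitely_presented R M \<and> div_ring (lmod_End R M)"

text \<open>
  Every finitely presented module is a quotient of some \<open>R\<^sup>n\<close>, so a class of pairwise
  non-isomorphic bricks is a set, and its members can be taken to live on one carrier type.
\<close>

definition semibrick :: "('r, 'p) ring_scheme \<Rightarrow> ('r, 'x, 'q) module_scheme set \<Rightarrow> bool"
  where "semibrick R \<X> \<longleftrightarrow>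
    (\<forall>X\<in>\<X>. brick R X) \<and>
    (\<forall>X\<in>\<X>. \<forall>X'\<in>\<X>. X \<noteq> X' \<longrightarrow>
      \<not> lmod_isomorphic R X X' \<and>
      (\<forall>h \<in> lmod_hom R X X'. \<forall>x \<in> carrier X. h x = \<zero>\<^bsub>X'\<^esub>))"

text \<open>
  The index set of the direct sum is taken in the carrier type of \<open>M\<close>.  This is no restriction:
  zero summands can be dropped, and then there are at most as many summands as elements of \<open>M\<close>
  (lemma \<open>semisimple_overI\<close> below, for an arbitrary index type).
\<close>

definition semisimple_over ::
  "('r, 'p) ring_scheme \<Rightarrow> ('r, 'x, 'q) module_scheme set \<Rightarrow> ('r, 'm, 's) module_scheme \<Rightarrow> bool"
  where "semisimple_over R \<X> M \<longleftrightarrow> left_module R M \<and>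
    (\<exists>(I :: 'm set) F. (\<forall>i\<in>I. F i \<in> \<X>) \<and> lmod_isomorphic R M (lmod_direct_sum I F))"

lemma semisimple_overI:
  fixes I :: "'i set" and M :: "('r, 'm, 's) module_scheme"
  assumes M: "left_module R M"
    and FX: "\<And>i. i \<in> I \<Longrightarrow> F i \<in> \<X>"
    and F: "\<And>i. i \<in> I \<Longrightarrow> left_module R (F i)"
    and iso: "lmod_isomorphic R M (lmod_direct_sum I F)"
  shows "semisimple_over R \<X> M"
proof -
  let ?S = "carrier (lmod_direct_sum I F)"
  obtain h where h: "h \<in> lmod_hom R M (lmod_direct_sum I F)" and bij: "bij_betw h (carrier M) ?S"
    using iso by (auto simp: lmod_isomorphic_def)
  have z: "\<zero>\<^bsub>F i\<^esub> \<in> carrier (F i)" if "i \<in> I" for i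
  proof -
    interpret left_module R "F i" using F that .
    show ?thesis by simp
  qed
  define I0 where "I0 = {i \<in> I. \<exists>x\<in>carrier (F i). x \<noteq> \<zero>\<^bsub>F i\<^esub>}"
  obtain e where e: "\<And>i. i \<in> I0 \<Longrightarrow> e i \<in> carrier (F i) \<and> e i \<noteq> \<zero>\<^bsub>F i\<^esub>"
  proof -
    have "\<forall>i. \<exists>x. i \<in> I0 \<longrightarrow> x \<in> carrier (F i) \<and> x \<noteq> \<zero>\<^bsub>F i\<^esub>" by (auto simp: I0_def)
    then show ?thesis using that by metis
  qed
  define s where "s = (\<lambda>i. \<lambda>k\<in>I. if k = i then e i else \<zero>\<^bsub>F k\<^esub>)"
  have s: "s i \<in> ?S" if "i \<in> I0" for i
  proof -
    have "{k \<in> I. s i k \<noteq> \<zero>\<^bsub>F k\<^esub>} \<subseteq> {i}" by (auto simp: s_def)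
    then have "finite {k \<in> I. s i k \<noteq> \<zero>\<^bsub>F k\<^esub>}" by (rule finite_subset) simp
    then show ?thesis using e[OF that] z by (auto simp: lmod_direct_sum_def s_def)
  qed
  define g where "g = (\<lambda>i. inv_into (carrier M) h (s i))"
  have hg: "h (g i) = s i" if "i \<in> I0" for i
    using s[OF that] bij unfolding g_def by (simp add: bij_betw_inv_into_right)
  have inj: "inj_on g I0"
  proof
    fix i j assume ij: "i \<in> I0" "j \<in> I0" and "g i = g j"
    then have eq: "s i i = s j i" using hg by metis
    show "i = j"
    proof (rule ccontr)
      assume "i \<noteq> j"
      then show False using eq e[OF ij(1)] ij by (auto simp: s_def I0_def)
    qed
  qed
  define J where "J = g ` I0"
  define u where "u = inv_into I0 g"
  have ug [simp]: "u (g i) = i" if "i \<in> I0" for i using inj that by (simp add: u_def)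
  have uJ: "u j \<in> I0 \<and> g (u j) = j" if "j \<in> J" for j using that by (auto simp: J_def)
  have uI: "u j \<in> I" if "j \<in> J" for j using uJ[OF that] by (simp add: I0_def)
  have hS: "h m \<in> ?S" if "m \<in> carrier M" for m using bij that by (auto simp: bij_betw_def)
  define \<phi> where "\<phi> = (\<lambda>m. \<lambda>j\<in>J. h m (u j))"
  let ?T = "lmod_direct_sum J (\<lambda>j. F (u j))"
  have \<phi>c: "\<phi> m \<in> carrier ?T" if "m \<in> carrier M" for m
  proof -
    have *: "h m \<in> (\<Pi>\<^sub>E i\<in>I. carrier (F i))" "finite {i \<in> I. h m i \<noteq> \<zero>\<^bsub>F i\<^esub>}"
      using hS[OF that] by (auto simp: lmod_direct_sum_def)
    have "{j \<in> J. \<phi> m j \<noteq> \<zero>\<^bsub>F (u j)\<^esub>} \<subseteq> g ` {i \<in> I. h m i \<noteq> \<zero>\<^bsub>F i\<^esub>}"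
    proof
      fix j assume "j \<in> {j \<in> J. \<phi> m j \<noteq> \<zero>\<^bsub>F (u j)\<^esub>}"
      then have "j \<in> J" "h m (u j) \<noteq> \<zero>\<^bsub>F (u j)\<^esub>" by (auto simp: \<phi>_def)
      then show "j \<in> g ` {i \<in> I. h m i \<noteq> \<zero>\<^bsub>F i\<^esub>}" using uJ[of j] uI[of j] by force
    qed
    then have "finite {j \<in> J. \<phi> m j \<noteq> \<zero>\<^bsub>F (u j)\<^esub>}" using *(2) finite_subset by blast
    then show ?thesis using *(1) uI by (auto simp: lmod_direct_sum_def \<phi>_def PiE_iff)
  qed
  have "\<phi> \<in> lmod_hom R M ?T"
    using h \<phi>c uI by (auto simp: lmod_hom_def lmod_direct_sum_def \<phi>_def fun_eq_iff)
  moreover have "bij_betw \<phi> (carrier M) (carrier ?T)"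
    unfolding bij_betw_def
  proof
    show "inj_on \<phi> (carrier M)"
    proof
      fix m m' assume m: "m \<in> carrier M" "m' \<in> carrier M" and eq: "\<phi> m = \<phi> m'"
      have *: "h m \<in> (\<Pi>\<^sub>E i\<in>I. carrier (F i))" "h m' \<in> (\<Pi>\<^sub>E i\<in>I. carrier (F i))"
        using hS m by (auto simp: lmod_direct_sum_def)
      have "h m k = h m' k" if k: "k \<in> I" for k
      proof (cases "k \<in> I0")
        case True
        then have "\<phi> m (g k) = h m k" "\<phi> m' (g k) = h m' k" by (auto simp: \<phi>_def J_def)
        then show ?thesis using eq by simp
      next
        case False
        have "h m k \<in> carrier (F k)" "h m' k \<in> carrier (F k)" using * k by (auto simp: PiE_iff)
        moreover have "\<forall>x\<in>carrier (F k). x = \<zero>\<^bsub>F k\<^esub>" using False k by (auto simp: I0_def)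
        ultimately show ?thesis by metis
      qed
      then have "h m = h m'" using * by (rule_tac PiE_ext) auto
      then show "m = m'" using bij m by (auto simp: bij_betw_def inj_on_def)
    qed
    show "\<phi> ` carrier M = carrier ?T"
    proof
      show "\<phi> ` carrier M \<subseteq> carrier ?T" using \<phi>c by auto
      show "carrier ?T \<subseteq> \<phi> ` carrier M"
      proof
        fix y assume "y \<in> carrier ?T"
        then have y: "y \<in> (\<Pi>\<^sub>E j\<in>J. carrier (F (u j)))" "finite {j \<in> J. y j \<noteq> \<zero>\<^bsub>F (u j)\<^esub>}"
          by (auto simp: lmod_direct_sum_def)
        define x where "x = (\<lambda>k\<in>I. if k \<in> I0 then y (g k) else \<zero>\<^bsub>F k\<^esub>)"
        have "{k \<in> I. x k \<noteq> \<zero>\<^bsub>F k\<^esub>} \<subseteq> u ` {j \<in> J. y j \<noteq> \<zero>\<^bsub>F (u j)\<^esub>}"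
        proof
          fix k assume "k \<in> {k \<in> I. x k \<noteq> \<zero>\<^bsub>F k\<^esub>}"
          then have "k \<in> I0" "y (g k) \<noteq> \<zero>\<^bsub>F k\<^esub>" by (auto simp: x_def split: if_splits)
          then show "k \<in> u ` {j \<in> J. y j \<noteq> \<zero>\<^bsub>F (u j)\<^esub>}"
            by (intro image_eqI[of _ _ "g k"]) (auto simp: J_def)
        qed
        then have "finite {k \<in> I. x k \<noteq> \<zero>\<^bsub>F k\<^esub>}" using y(2) finite_subset by blast
        moreover have "y (g k) \<in> carrier (F k)" if "k \<in> I0" for k
          using PiE_mem[OF y(1), of "g k"] that by (simp add: J_def)
        ultimately have "x \<in> ?S" using z by (auto simp: lmod_direct_sum_def x_def)
        then obtain m where m: "m \<in> carrier M" "h m = x" using bij by (metis bij_betw_def imageE)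
        have "\<phi> m = y"
        proof
          fix j show "\<phi> m j = y j"
            using y(1) uJ[of j] uI[of j] m(2) by (cases "j \<in> J") (auto simp: \<phi>_def x_def PiE_iff extensional_def)
        qed
        then show "y \<in> \<phi> ` carrier M" using m(1) by auto
      qed
    qed
  qed
  moreover have "\<forall>j\<in>J. F (u j) \<in> \<X>" using FX uI by auto
  ultimately have "(\<forall>j\<in>J. F (u j) \<in> \<X>) \<and> lmod_isomorphic R M ?T"
    unfolding lmod_isomorphic_def by blast
  then show ?thesis
    using M unfolding semisimple_over_def by (intro conjI exI[of _ J] exI[of _ "\<lambda>j. F (u j)"]) auto
qed

lemma left_module_regular:
  assumes "ring R"
  shows "left_module R (regular_lmod R)"
proof -
  interpret ring R by fact
  have "abelian_group (regular_lmod R)"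
  proof (rule abelian_groupI, goal_cases)
    case (6 x)
    then show ?case using l_neg[of x] a_inv_closed[of x] by (auto simp: regular_lmod_def)
  qed (auto simp: regular_lmod_def a_ac)
  then show ?thesis
    by (intro left_module.intro left_module_axioms.intro assms)
      (auto simp: regular_lmod_def l_distr r_distr m_assoc)
qed

lemma left_module_smult_zero:
  assumes "left_module R M" "a \<in> carrier R"
  shows "a \<odot>\<^bsub>M\<^esub> \<zero>\<^bsub>M\<^esub> = \<zero>\<^bsub>M\<^esub>"
proof -
  interpret left_module R M by fact
  have "a \<odot>\<^bsub>M\<^esub> \<zero>\<^bsub>M\<^esub> \<oplus>\<^bsub>M\<^esub> a \<odot>\<^bsub>M\<^esub> \<zero>\<^bsub>M\<^esub> = a \<odot>\<^bsub>M\<^esub> \<zero>\<^bsub>M\<^esub>"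
    using smult_r_distr[of a "\<zero>\<^bsub>M\<^esub>" "\<zero>\<^bsub>M\<^esub>"] assms(2) by simp
  then show ?thesis using assms(2) by simp
qed

lemma left_module_direct_sum:
  assumes "ring R" and F: "\<And>i. i \<in> I \<Longrightarrow> left_module R (F i)"
  shows "left_module R (lmod_direct_sum I F)"
proof -
  note grp = left_module.axioms(2)[OF F]
  note mon = abelian_group.axioms(1)[OF grp]
  note simps = abelian_monoid.a_closed[OF mon] abelian_monoid.zero_closed[OF mon]
    abelian_monoid.l_zero[OF mon] abelian_group.a_inv_closed[OF grp]
    abelian_group.l_neg[OF grp] left_module.smult_closed[OF F] left_module.smult_one[OF F]
  have "abelian_group (lmod_direct_sum I F)"
  proof (rule abelian_groupI, goal_cases)
    case (1 x y)
    then have "finite ({i \<in> I. x i \<noteq> \<zero>\<^bsub>F i\<^esub>} \<union> {i \<in> I. y i \<noteq> \<zero>\<^bsub>F i\<^esub>})"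
      by (auto simp: lmod_direct_sum_def)
    then have "finite {i \<in> I. x i \<oplus>\<^bsub>F i\<^esub> y i \<noteq> \<zero>\<^bsub>F i\<^esub>}"
      by (rule rev_finite_subset) (auto simp: simps)
    then show ?case using 1
      by (auto simp: lmod_direct_sum_def PiE_iff simps cong: conj_cong)
  next
    case 2
    then show ?case by (auto simp: lmod_direct_sum_def simps cong: conj_cong)
  next
    case (3 x y z)
    then show ?case
      by (auto simp: lmod_direct_sum_def PiE_iff fun_eq_iff abelian_monoid.a_assoc[OF mon])
  next
    case (4 x y)
    then show ?case
      by (auto simp: lmod_direct_sum_def PiE_iff fun_eq_iff abelian_monoid.a_comm[OF mon])
  next
    case (5 x)
    then show ?case
      by (auto simp: lmod_direct_sum_def PiE_iff fun_eq_iff simps extensional_def)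
  next
    case (6 x)
    let ?y = "\<lambda>i\<in>I. \<ominus>\<^bsub>F i\<^esub> x i"
    have "finite {i \<in> I. x i \<noteq> \<zero>\<^bsub>F i\<^esub>}" using 6 by (auto simp: lmod_direct_sum_def)
    then have "finite {i \<in> I. \<ominus>\<^bsub>F i\<^esub> x i \<noteq> \<zero>\<^bsub>F i\<^esub>}"
    proof (rule rev_finite_subset)
      have "\<ominus>\<^bsub>F i\<^esub> \<zero>\<^bsub>F i\<^esub> = \<zero>\<^bsub>F i\<^esub>" if "i \<in> I" for i
        by (rule abelian_group.minus_equality[OF grp[OF that]]) (simp_all add: that simps)
      then show "{i \<in> I. \<ominus>\<^bsub>F i\<^esub> x i \<noteq> \<zero>\<^bsub>F i\<^esub>} \<subseteq> {i \<in> I. x i \<noteq> \<zero>\<^bsub>F i\<^esub>}" by auto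
    qed
    then have "?y \<in> carrier (lmod_direct_sum I F)" using 6
      by (auto simp: lmod_direct_sum_def PiE_iff simps cong: conj_cong)
    moreover have "?y \<oplus>\<^bsub>lmod_direct_sum I F\<^esub> x = \<zero>\<^bsub>lmod_direct_sum I F\<^esub>" using 6
      by (auto simp: lmod_direct_sum_def PiE_iff fun_eq_iff simps)
    ultimately show ?case by blast
  qed
  moreover have "left_module_axioms R (lmod_direct_sum I F)"
  proof (rule left_module_axioms.intro, goal_cases)
    case (1 a x)
    then have "finite {i \<in> I. x i \<noteq> \<zero>\<^bsub>F i\<^esub>}" by (auto simp: lmod_direct_sum_def)
    then have "finite {i \<in> I. a \<odot>\<^bsub>F i\<^esub> x i \<noteq> \<zero>\<^bsub>F i\<^esub>}"
      by (rule rev_finite_subset) (auto simp: left_module_smult_zero[OF F] 1)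
    then show ?case using 1
      by (auto simp: lmod_direct_sum_def PiE_iff simps cong: conj_cong)
  qed (auto simp: lmod_direct_sum_def PiE_iff fun_eq_iff simps extensional_def
        left_module.smult_l_distr[OF F] left_module.smult_r_distr[OF F] left_module.smult_assoc[OF F])
  ultimately show ?thesis using assms(1) by (intro left_module.intro)
qed

lemma ring_lmod_End:
  assumes "left_module R M"
  shows "ring (lmod_End R M)"
proof -
  interpret left_module R M by fact
  have "abelian_group (lmod_End R M)"
  proof (rule abelian_groupI, goal_cases)
    case (6 x)
    let ?y = "\<lambda>m\<in>carrier M. \<ominus>\<^bsub>M\<^esub> x m"
    have x: "x \<in> carrier M \<rightarrow> carrier M"
      "\<And>a b. a \<in> carrier M \<Longrightarrow> b \<in> carrier M \<Longrightarrow> x (a \<oplus>\<^bsub>M\<^esub> b) = x a \<oplus>\<^bsub>M\<^esub> x b"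
      "\<And>r b. r \<in> carrier R \<Longrightarrow> b \<in> carrier M \<Longrightarrow> x (r \<odot>\<^bsub>M\<^esub> b) = r \<odot>\<^bsub>M\<^esub> x b"
      using 6 by (auto simp: lmod_End_def lmod_hom_def)
    have neg: "\<ominus>\<^bsub>M\<^esub> (r \<odot>\<^bsub>M\<^esub> b) = r \<odot>\<^bsub>M\<^esub> (\<ominus>\<^bsub>M\<^esub> b)" if "r \<in> carrier R" "b \<in> carrier M" for r b
    proof -
      have "r \<odot>\<^bsub>M\<^esub> (\<ominus>\<^bsub>M\<^esub> b) \<oplus>\<^bsub>M\<^esub> r \<odot>\<^bsub>M\<^esub> b = \<zero>\<^bsub>M\<^esub>"
        using that smult_r_distr[of r "\<ominus>\<^bsub>M\<^esub> b" b] left_module_smult_zero[OF assms]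
        by (simp add: M.l_neg)
      then show ?thesis using that by (metis M.minus_equality M.a_inv_closed smult_closed)
    qed
    have "?y \<in> carrier (lmod_End R M)"
      using x by (auto simp: lmod_End_def lmod_hom_def Pi_iff M.minus_add neg)
    moreover have "?y \<oplus>\<^bsub>lmod_End R M\<^esub> x = \<zero>\<^bsub>lmod_End R M\<^esub>"
      using x by (auto simp: lmod_End_def fun_eq_iff M.l_neg Pi_iff)
    ultimately show ?case by blast
  qed (auto simp: lmod_End_def lmod_hom_def Pi_iff fun_eq_iff M.a_ac smult_r_distr
        left_module_smult_zero[OF assms] extensional_def)
  moreover have "monoid (lmod_End R M)"
    by (rule monoidI)
      (auto simp: lmod_End_def lmod_hom_def Pi_iff fun_eq_iff compose_def extensional_def)
  ultimately show ?thesis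
    by (rule ringI)
      (auto simp: lmod_End_def lmod_hom_def Pi_iff fun_eq_iff compose_def extensional_def)
qed

end

theory Submission
  imports Defs
begin

text \<open>
  Write \<open>M\<close> and \<open>N\<close> as direct sums of bricks.  Between members of the semibrick every nonzero
  homomorphism is bijective, so \<open>f\<close> is a matrix over division rings and linear algebra applies.
  If \<open>f\<close> is injective on the sum over a finite index set \<open>A\<close>, Gaussian elimination yields
  coordinates \<open>B\<close> of \<open>N\<close> for which the corresponding block of \<open>f\<close> is invertible; hence for every
  further summand either its image lies in the image of the sum over \<open>A\<close>, or injectivity extends to
  it.  By Zorn's lemma there is a set \<open>T\<close> of summands of \<open>M\<close> whose sum is mapped isomorphically onto
  the image of \<open>f\<close>, so the kernel is isomorphic to the sum of the other summands.  The same argument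
  for \<open>M \<oplus> N \<rightarrow> N\<close> extends \<open>T\<close> to a set whose sum is mapped isomorphically onto \<open>N\<close>; the added summands
  form a complement of the image of \<open>f\<close>, isomorphic to the cokernel.
\<close>

section \<open>Homomorphisms of left modules\<close>

lemma (in abelian_group) minus_eq_zeroD:
  assumes "x \<in> carrier G" "y \<in> carrier G" "x \<ominus> y = \<zero>"
  shows "x = y"
  using assms minus_equality[of x "\<ominus> y"] by (simp add: minus_eq)

lemma (in abelian_group) minus_self: "x \<in> carrier G \<Longrightarrow> x \<ominus> x = \<zero>"
  by (simp add: minus_eq r_neg)

lemma lmod_homI:
  assumes "\<And>x. x \<in> carrier M \<Longrightarrow> h x \<in> carrier N"
    and "\<And>x y. x \<in> carrier M \<Longrightarrow> y \<in> carrier M \<Longrightarrow> h (x \<oplus>\<^bsub>M\<^esub> y) = h x \<oplus>\<^bsub>N\<^esub> h y"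
    and "\<And>a x. a \<in> carrier R \<Longrightarrow> x \<in> carrier M \<Longrightarrow> h (a \<odot>\<^bsub>M\<^esub> x) = a \<odot>\<^bsub>N\<^esub> h x"
  shows "h \<in> lmod_hom R M N"
  using assms by (auto simp: lmod_hom_def)

lemma lmod_hom_closed: "h \<in> lmod_hom R M N \<Longrightarrow> x \<in> carrier M \<Longrightarrow> h x \<in> carrier N"
  by (auto simp: lmod_hom_def)

lemma lmod_hom_add:
  "h \<in> lmod_hom R M N \<Longrightarrow> x \<in> carrier M \<Longrightarrow> y \<in> carrier M \<Longrightarrow> h (x \<oplus>\<^bsub>M\<^esub> y) = h x \<oplus>\<^bsub>N\<^esub> h y"
  by (auto simp: lmod_hom_def)

lemma lmod_hom_smult:
  "h \<in> lmod_hom R M N \<Longrightarrow> a \<in> carrier R \<Longrightarrow> x \<in> carrier M \<Longrightarrow> h (a \<odot>\<^bsub>M\<^esub> x) = a \<odot>\<^bsub>N\<^esub> h x"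
  by (auto simp: lmod_hom_def)

lemma lmod_hom_zero:
  assumes "left_module R M" "left_module R N" "h \<in> lmod_hom R M N"
  shows "h \<zero>\<^bsub>M\<^esub> = \<zero>\<^bsub>N\<^esub>"
proof -
  interpret M: left_module R M by fact
  interpret N: left_module R N by fact
  have "h \<zero>\<^bsub>M\<^esub> \<oplus>\<^bsub>N\<^esub> h \<zero>\<^bsub>M\<^esub> = h \<zero>\<^bsub>M\<^esub>"
    using lmod_hom_add[OF assms(3), of "\<zero>\<^bsub>M\<^esub>" "\<zero>\<^bsub>M\<^esub>"] by simp
  then show ?thesis using lmod_hom_closed[OF assms(3), of "\<zero>\<^bsub>M\<^esub>"] by simp
qed

lemma lmod_hom_diff:
  assumes "left_module R M" "left_module R N" "h \<in> lmod_hom R M N"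
    and "x \<in> carrier M" "y \<in> carrier M"
  shows "h (x \<ominus>\<^bsub>M\<^esub> y) = h x \<ominus>\<^bsub>N\<^esub> h y"
proof -
  interpret M: left_module R M by fact
  interpret N: left_module R N by fact
  have "h (\<ominus>\<^bsub>M\<^esub> y) \<oplus>\<^bsub>N\<^esub> h y = \<zero>\<^bsub>N\<^esub>"
    using lmod_hom_add[OF assms(3), of "\<ominus>\<^bsub>M\<^esub> y" y] lmod_hom_zero[OF assms(1-3)] assms(5)
    by (simp add: M.M.l_neg)
  then have "\<ominus>\<^bsub>N\<^esub> h y = h (\<ominus>\<^bsub>M\<^esub> y)"
    using assms(5) by (intro N.M.minus_equality) (auto intro: lmod_hom_closed[OF assms(3)])
  then show ?thesis
    using lmod_hom_add[OF assms(3), of x "\<ominus>\<^bsub>M\<^esub> y"] assms(4,5) by (simp add: a_minus_def)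
qed

lemma lmod_hom_compose:
  assumes "h \<in> lmod_hom R M N" "k \<in> lmod_hom R N L"
  shows "(\<lambda>x. k (h x)) \<in> lmod_hom R M L"
  using assms by (auto simp: lmod_hom_def Pi_iff)

lemma lmod_hom_plus:
  assumes "left_module R N" "h \<in> lmod_hom R M N" "k \<in> lmod_hom R M N"
  shows "(\<lambda>x. h x \<oplus>\<^bsub>N\<^esub> k x) \<in> lmod_hom R M N"
proof -
  interpret left_module R N by fact
  show ?thesis using assms(2,3)
    by (auto simp: lmod_hom_def Pi_iff M.a_ac smult_r_distr)
qed

lemma lmod_hom_uminus:
  assumes "left_module R N" "left_module R M" "h \<in> lmod_hom R M N"
  shows "(\<lambda>x. \<ominus>\<^bsub>N\<^esub> h x) \<in> lmod_hom R M N"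
proof -
  interpret left_module R N by fact
  have neg: "\<ominus>\<^bsub>N\<^esub> (r \<odot>\<^bsub>N\<^esub> b) = r \<odot>\<^bsub>N\<^esub> (\<ominus>\<^bsub>N\<^esub> b)" if "r \<in> carrier R" "b \<in> carrier N" for r b
  proof (rule M.minus_equality)
    show "r \<odot>\<^bsub>N\<^esub> (\<ominus>\<^bsub>N\<^esub> b) \<oplus>\<^bsub>N\<^esub> r \<odot>\<^bsub>N\<^esub> b = \<zero>\<^bsub>N\<^esub>"
      using that smult_r_distr[of r "\<ominus>\<^bsub>N\<^esub> b" b] left_module_smult_zero[OF assms(1)]
      by (simp add: M.l_neg)
  qed (use that in auto)
  show ?thesis using assms(3)
    by (auto simp: lmod_hom_def Pi_iff neg M.minus_add)
qed

lemma lmod_hom_minus: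
  assumes "left_module R N" "left_module R M" "h \<in> lmod_hom R M N" "k \<in> lmod_hom R M N"
  shows "(\<lambda>x. h x \<ominus>\<^bsub>N\<^esub> k x) \<in> lmod_hom R M N"
  unfolding a_minus_def
  by (rule lmod_hom_plus[OF assms(1,3) lmod_hom_uminus[OF assms(1,2,4)]])

lemma lmod_hom_inv_into:
  assumes M: "left_module R M" and h: "h \<in> lmod_hom R M N" and b: "bij_betw h (carrier M) (carrier N)"
  shows "inv_into (carrier M) h \<in> lmod_hom R N M"
proof -
  interpret left_module R M by fact
  let ?k = "inv_into (carrier M) h"
  have k: "?k y \<in> carrier M" "h (?k y) = y" if "y \<in> carrier N" for y
    using b that bij_betw_inv_into_right[OF b] bij_betwE[OF bij_betw_inv_into[OF b]] by auto
  have kh: "?k (h x) = x" if "x \<in> carrier M" for x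
    using b that by (simp add: bij_betw_inv_into_left)
  show ?thesis
  proof (rule lmod_homI)
    fix x y assume xy: "x \<in> carrier N" "y \<in> carrier N"
    have "?k (h (?k x \<oplus>\<^bsub>M\<^esub> ?k y)) = ?k x \<oplus>\<^bsub>M\<^esub> ?k y" using k xy by (intro kh) auto
    then show "?k (x \<oplus>\<^bsub>N\<^esub> y) = ?k x \<oplus>\<^bsub>M\<^esub> ?k y" using lmod_hom_add[OF h] k xy by simp
  next
    fix a x assume ax: "a \<in> carrier R" "x \<in> carrier N"
    have "?k (h (a \<odot>\<^bsub>M\<^esub> ?k x)) = a \<odot>\<^bsub>M\<^esub> ?k x" using k ax by (intro kh) auto
    then show "?k (a \<odot>\<^bsub>N\<^esub> x) = a \<odot>\<^bsub>M\<^esub> ?k x" using lmod_hom_smult[OF h] k ax by simp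
  qed (use k in auto)
qed

lemma lmod_isomorphic_sym:
  assumes "left_module R M" "lmod_isomorphic R M N"
  shows "lmod_isomorphic R N M"
  using assms lmod_hom_inv_into bij_betw_inv_into unfolding lmod_isomorphic_def by blast

text \<open>Every module axiom of \<open>N\<close> is pulled back to representatives in
  \<open>M\<close>. Since \<open>N\<close> is not yet known to be a group, cancellation cannot show
  that \<open>h\<close> preserves zero, so this is assumed. The lemma serves the cokernel, whose
  carrier consists of cosets.\<close>

lemma left_module_surj_image:
  assumes M: "left_module R M" and h: "h \<in> lmod_hom R M N"
    and surj: "h ` carrier M = carrier N" and zero: "h \<zero>\<^bsub>M\<^esub> = \<zero>\<^bsub>N\<^esub>"
  shows "left_module R N"
proof -
  interpret left_module R M by fact
  note add = lmod_hom_add[OF h, symmetric] and smult = lmod_hom_smult[OF h, symmetric]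
  have ex: "\<exists>x\<in>carrier M. y = h x" if "y \<in> carrier N" for y using surj that by auto
  have cl: "h x \<in> carrier N" if "x \<in> carrier M" for x using surj that by auto
  have "abelian_group N"
  proof (rule abelian_groupI, goal_cases)
    case (1 x y) then show ?case using ex[of x] ex[of y] by (auto simp: add cl)
  next
    case 2 then show ?case using zero cl[of "\<zero>\<^bsub>M\<^esub>"] by simp
  next
    case (3 x y z) then show ?case using ex[of x] ex[of y] ex[of z] by (auto simp: add M.a_assoc)
  next
    case (4 x y) then show ?case using ex[of x] ex[of y] by (auto simp: add M.a_comm)
  next
    case (5 x) then show ?case using ex[of x] by (auto simp: add simp flip: zero)
  next
    case (6 x)
    then obtain u where u: "u \<in> carrier M" "x = h u" using ex by blast
    then have "h (\<ominus>\<^bsub>M\<^esub> u) \<oplus>\<^bsub>N\<^esub> x = \<zero>\<^bsub>N\<^esub>" by (simp add: add M.l_neg zero)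
    then show ?case using cl[of "\<ominus>\<^bsub>M\<^esub> u"] u by auto
  qed
  moreover have "left_module_axioms R N"
  proof (rule left_module_axioms.intro, goal_cases)
    case (1 a x) then show ?case using ex[of x] by (auto simp: smult cl)
  next
    case (2 a b x) then show ?case using ex[of x] by (auto simp: smult add smult_l_distr)
  next
    case (3 a x y) then show ?case using ex[of x] ex[of y] by (auto simp: smult add smult_r_distr)
  next
    case (4 a b x) then show ?case using ex[of x] by (auto simp: smult smult_assoc)
  next
    case (5 x) then show ?case using ex[of x] by (auto simp: smult)
  qed
  ultimately show ?thesis by (intro left_module.intro R.ring_axioms)
qed

section \<open>Kernels and cokernels as modules\<close>

lemma left_module_kernel:
  assumes M: "left_module R M" and N: "left_module R N" and h: "h \<in> lmod_hom R M N"
  shows "left_module R (lmod_kernel M N h)"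
proof -
  interpret M: left_module R M by fact
  interpret N: left_module R N by fact
  have ker: "a_kernel M N h = {x \<in> carrier M. h x = \<zero>\<^bsub>N\<^esub>}"
    by (auto simp: a_kernel_def kernel_def)
  note simps = ker lmod_kernel_def lmod_hom_add[OF h] lmod_hom_smult[OF h] lmod_hom_zero[OF M N h]
  have "abelian_group (lmod_kernel M N h)"
  proof (rule abelian_groupI, goal_cases)
    case (6 x)
    then have x: "x \<in> carrier M" "h x = \<zero>\<^bsub>N\<^esub>" by (auto simp: simps)
    have "h (\<zero>\<^bsub>M\<^esub> \<ominus>\<^bsub>M\<^esub> x) = \<zero>\<^bsub>N\<^esub>"
      using lmod_hom_diff[OF M N h, of "\<zero>\<^bsub>M\<^esub>" x] x by (simp add: simps N.M.minus_eq)
    then have "\<ominus>\<^bsub>M\<^esub> x \<in> carrier (lmod_kernel M N h)" using x by (simp add: simps M.M.minus_eq)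
    then show ?case using x by (auto simp: simps M.M.l_neg intro!: bexI[of _ "\<ominus>\<^bsub>M\<^esub> x"])
  qed (auto simp: simps M.M.a_ac)
  moreover have "left_module_axioms R (lmod_kernel M N h)"
    by (rule left_module_axioms.intro)
      (auto simp: simps left_module_smult_zero[OF N] M.smult_l_distr M.smult_r_distr M.smult_assoc)
  ultimately show ?thesis by (intro left_module.intro M.R.ring_axioms)
qed

lemma lmod_coker_proj:
  assumes M: "left_module R M" and N: "left_module R N" and h: "h \<in> lmod_hom R M N"
  defines "U \<equiv> h ` carrier M"
  shows lmod_coker_proj_hom: "(\<lambda>y. U +>\<^bsub>N\<^esub> y) \<in> lmod_hom R N (lmod_coker M N h)"
    and lmod_coker_proj_surj: "(\<lambda>y. U +>\<^bsub>N\<^esub> y) ` carrier N = carrier (lmod_coker M N h)"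
    and lmod_coker_proj_eq_zero_iff:
      "y \<in> carrier N \<Longrightarrow> U +>\<^bsub>N\<^esub> y = \<zero>\<^bsub>lmod_coker M N h\<^esub> \<longleftrightarrow> y \<in> U"
proof -
  interpret M: left_module R M by fact
  interpret N: left_module R N by fact
  have Uc: "U \<subseteq> carrier N" using lmod_hom_closed[OF h] by (auto simp: U_def)
  have "subgroup U (add_monoid N)"
  proof (rule N.M.add.subgroupI, goal_cases)
    case 2 then show ?case by (auto simp: U_def)
  next
    case (3 a)
    then obtain x where x: "x \<in> carrier M" "a = h x" by (auto simp: U_def)
    have "h (\<zero>\<^bsub>M\<^esub> \<ominus>\<^bsub>M\<^esub> x) = \<ominus>\<^bsub>N\<^esub> a"
      using lmod_hom_diff[OF M N h, of "\<zero>\<^bsub>M\<^esub>" x] x lmod_hom_closed[OF h]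
      by (simp add: lmod_hom_zero[OF M N h] N.M.minus_eq)
    then show ?case using x unfolding U_def a_inv_def by (metis M.M.minus_closed M.M.zero_closed imageI)
  next
    case (4 a b)
    then show ?case by (auto simp: U_def simp flip: lmod_hom_add[OF h])
  qed (use Uc in auto)
  then have "additive_subgroup U N" by (rule additive_subgroup.intro)
  then interpret U: abelian_subgroup U N by (intro abelian_subgroupI3 N.M.abelian_group_axioms)
  have smU: "a \<odot>\<^bsub>N\<^esub> u \<in> U" if "a \<in> carrier R" "u \<in> U" for a u
    using that by (auto simp: U_def simp flip: lmod_hom_smult[OF h])
  show "(\<lambda>y. U +>\<^bsub>N\<^esub> y) \<in> lmod_hom R N (lmod_coker M N h)"
  proof (rule lmod_homI)
    fix x assume "x \<in> carrier N"
    then show "U +>\<^bsub>N\<^esub> x \<in> carrier (lmod_coker M N h)"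
      by (auto simp: lmod_coker_def lmod_quotient_def A_RCOSETS_def' U_def)
  next
    fix x y assume "x \<in> carrier N" "y \<in> carrier N"
    then show "U +>\<^bsub>N\<^esub> (x \<oplus>\<^bsub>N\<^esub> y) = (U +>\<^bsub>N\<^esub> x) \<oplus>\<^bsub>lmod_coker M N h\<^esub> (U +>\<^bsub>N\<^esub> y)"
      by (simp add: lmod_coker_def lmod_quotient_def U.a_rcos_sum)
  next
    fix a x assume ax: "a \<in> carrier R" "x \<in> carrier N"
    \<comment> \<open>Well-definedness of the scalar action on cosets: since \<open>U\<close> is
      closed under scalars, \<open>a\<close> times any representative of the coset of
      \<open>x\<close> lies in the coset of \<open>a\<close> times \<open>x\<close>.\<close>
    have eq: "U +>\<^bsub>N\<^esub> (a \<odot>\<^bsub>N\<^esub> z) = U +>\<^bsub>N\<^esub> (a \<odot>\<^bsub>N\<^esub> x)" if z: "z \<in> U +>\<^bsub>N\<^esub> x" for z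
    proof -
      obtain u where u: "u \<in> U" "z = u \<oplus>\<^bsub>N\<^esub> x" using z by (auto simp: a_r_coset_def')
      then have "a \<odot>\<^bsub>N\<^esub> z = a \<odot>\<^bsub>N\<^esub> u \<oplus>\<^bsub>N\<^esub> a \<odot>\<^bsub>N\<^esub> x" using ax Uc by (auto simp: N.smult_r_distr)
      then have "a \<odot>\<^bsub>N\<^esub> z \<in> U +>\<^bsub>N\<^esub> (a \<odot>\<^bsub>N\<^esub> x)" using smU[OF ax(1) u(1)] by (auto simp: a_r_coset_def')
      then show ?thesis using ax by (intro U.a_repr_independence'[symmetric]) auto
    qed
    \<comment> \<open>The coset is nonempty and all members of the union in the definition of the
      action coincide, so the union is this single coset.\<close>
    have "x \<in> U +>\<^bsub>N\<^esub> x" using ax(2) by (rule U.a_rcos_self)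
    then have "(\<Union>z\<in>U +>\<^bsub>N\<^esub> x. U +>\<^bsub>N\<^esub> (a \<odot>\<^bsub>N\<^esub> z)) = U +>\<^bsub>N\<^esub> (a \<odot>\<^bsub>N\<^esub> x)"
      using eq by blast
    then show "U +>\<^bsub>N\<^esub> (a \<odot>\<^bsub>N\<^esub> x) = a \<odot>\<^bsub>lmod_coker M N h\<^esub> (U +>\<^bsub>N\<^esub> x)"
      by (simp add: lmod_coker_def lmod_quotient_def U_def)
  qed
  show "(\<lambda>y. U +>\<^bsub>N\<^esub> y) ` carrier N = carrier (lmod_coker M N h)"
    by (auto simp: lmod_coker_def lmod_quotient_def A_RCOSETS_def' U_def)
  assume y: "y \<in> carrier N"
  have "U +>\<^bsub>N\<^esub> y = U \<longleftrightarrow> y \<in> U"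
  proof
    show "y \<in> U" if "U +>\<^bsub>N\<^esub> y = U" using U.a_rcos_self[OF y] unfolding that .
    show "U +>\<^bsub>N\<^esub> y = U" if "y \<in> U" using U.a_rcos_const[OF that] .
  qed
  then show "U +>\<^bsub>N\<^esub> y = \<zero>\<^bsub>lmod_coker M N h\<^esub> \<longleftrightarrow> y \<in> U"
    by (simp add: lmod_coker_def lmod_quotient_def U_def)
qed

lemma left_module_coker:
  assumes M: "left_module R M" and N: "left_module R N" and h: "h \<in> lmod_hom R M N"
  shows "left_module R (lmod_coker M N h)"
proof (rule left_module_surj_image[OF N lmod_coker_proj_hom[OF assms] lmod_coker_proj_surj[OF assms]])
  interpret M: left_module R M by fact
  interpret N: left_module R N by fact
  have "\<zero>\<^bsub>N\<^esub> \<in> h ` carrier M" using lmod_hom_zero[OF assms] by (metis M.M.zero_closed imageI)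
  then show "(h ` carrier M) +>\<^bsub>N\<^esub> \<zero>\<^bsub>N\<^esub> = \<zero>\<^bsub>lmod_coker M N h\<^esub>"
    using lmod_coker_proj_eq_zero_iff[OF assms, of "\<zero>\<^bsub>N\<^esub>"] by simp
qed

lemma lmod_hom_inj_onI:
  assumes "left_module R M" "left_module R N" "h \<in> lmod_hom R M N"
    and "\<And>x. x \<in> carrier M \<Longrightarrow> h x = \<zero>\<^bsub>N\<^esub> \<Longrightarrow> x = \<zero>\<^bsub>M\<^esub>"
  shows "inj_on h (carrier M)"
proof
  interpret M: left_module R M by fact
  interpret N: left_module R N by fact
  fix x y assume xy: "x \<in> carrier M" "y \<in> carrier M" "h x = h y"
  then have "h (x \<ominus>\<^bsub>M\<^esub> y) = \<zero>\<^bsub>N\<^esub>"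
    using lmod_hom_diff[OF assms(1-3)] lmod_hom_closed[OF assms(3)] by (simp add: N.M.minus_self)
  then have "x \<ominus>\<^bsub>M\<^esub> y = \<zero>\<^bsub>M\<^esub>" using assms(4) xy by simp
  then show "x = y" using xy M.M.minus_eq_zeroD by blast
qed

section \<open>Direct sums\<close>

lemma direct_sum_memD:
  assumes "x \<in> carrier (lmod_direct_sum K X)"
  shows "x \<in> extensional K" "k \<in> K \<Longrightarrow> x k \<in> carrier (X k)" "finite {k \<in> K. x k \<noteq> \<zero>\<^bsub>X k\<^esub>}"
  using assms by (auto simp: lmod_direct_sum_def PiE_iff)

lemma direct_sum_eqI:
  assumes "x \<in> carrier (lmod_direct_sum K X)" "y \<in> carrier (lmod_direct_sum K X)"
    and "\<And>k. k \<in> K \<Longrightarrow> x k = y k"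
  shows "x = y"
  using assms direct_sum_memD(1) by (metis extensionalityI)

lemma direct_sum_zero: "k \<in> K \<Longrightarrow> \<zero>\<^bsub>lmod_direct_sum K X\<^esub> k = \<zero>\<^bsub>X k\<^esub>"
  by (simp add: lmod_direct_sum_def)

lemma direct_sum_component_hom: "k \<in> K \<Longrightarrow> (\<lambda>x. x k) \<in> lmod_hom R (lmod_direct_sum K X) (X k)"
  by (auto simp: lmod_hom_def lmod_direct_sum_def)

text \<open>For injective \<open>u\<close> this is a projection onto some of the summands, renamed
  by \<open>S\<close>. It is used with \<open>Inl\<close> and \<open>Inr\<close> to split a sum over
  \<open>I <+> J\<close> into two blocks, and with \<open>id\<close> to project onto the summands
  indexed by a subset.\<close>

definition direct_sum_pull :: "'s set \<Rightarrow> ('s \<Rightarrow> 'k) \<Rightarrow> ('k \<Rightarrow> 'x) \<Rightarrow> 's \<Rightarrow> 'x"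
  where "direct_sum_pull S u x = (\<lambda>s\<in>S. x (u s))"

lemma direct_sum_pull_hom:
  assumes u: "inj_on u S" "u ` S \<subseteq> K" and Y: "\<And>s. s \<in> S \<Longrightarrow> Y s = X (u s)"
  shows "direct_sum_pull S u \<in> lmod_hom R (lmod_direct_sum K X) (lmod_direct_sum S Y)"
proof (rule lmod_homI)
  fix x assume x: "x \<in> carrier (lmod_direct_sum K X)"
  \<comment> \<open>The support is bounded after applying \<open>u\<close>; injectivity of
    \<open>u\<close> brings finiteness back to \<open>S\<close>.\<close>
  have "u ` {s \<in> S. direct_sum_pull S u x s \<noteq> \<zero>\<^bsub>Y s\<^esub>} \<subseteq> {k \<in> K. x k \<noteq> \<zero>\<^bsub>X k\<^esub>}"
    using u(2) by (auto simp: Y direct_sum_pull_def)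
  then have "finite (u ` {s \<in> S. direct_sum_pull S u x s \<noteq> \<zero>\<^bsub>Y s\<^esub>})"
    using direct_sum_memD(3)[OF x] by (rule finite_subset)
  then have "finite {s \<in> S. direct_sum_pull S u x s \<noteq> \<zero>\<^bsub>Y s\<^esub>}"
    by (rule finite_imageD) (rule inj_on_subset[OF u(1)], auto)
  then show "direct_sum_pull S u x \<in> carrier (lmod_direct_sum S Y)"
    using u(2) direct_sum_memD(2)[OF x] by (auto simp: lmod_direct_sum_def Y direct_sum_pull_def)
qed (use u(2) in \<open>auto simp: lmod_direct_sum_def Y direct_sum_pull_def fun_eq_iff\<close>)

text \<open>Extension by zero: for injective \<open>u\<close> into \<open>K\<close> it embeds the
  sum over \<open>S\<close> as a partial sum, and \<open>direct_sum_pull\<close> is a left inverse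
  of it.\<close>

definition direct_sum_push ::
  "'k set \<Rightarrow> ('k \<Rightarrow> ('r, 'x, 'q) module_scheme) \<Rightarrow> 's set \<Rightarrow> ('s \<Rightarrow> 'k) \<Rightarrow> ('s \<Rightarrow> 'x) \<Rightarrow> 'k \<Rightarrow> 'x"
  where "direct_sum_push K X S u x =
    (\<lambda>k\<in>K. if k \<in> u ` S then x (inv_into S u k) else \<zero>\<^bsub>X k\<^esub>)"

lemma direct_sum_push_apply:
  assumes "inj_on u S" "u ` S \<subseteq> K" "s \<in> S"
  shows "direct_sum_push K X S u x (u s) = x s"
  using assms by (auto simp: direct_sum_push_def)

lemma direct_sum_push_apply_notin:
  "k \<in> K \<Longrightarrow> k \<notin> u ` S \<Longrightarrow> direct_sum_push K X S u x k = \<zero>\<^bsub>X k\<^esub>"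
  by (simp add: direct_sum_push_def)

lemma direct_sum_push_hom:
  assumes u: "inj_on u S" "u ` S \<subseteq> K" and Y: "\<And>s. s \<in> S \<Longrightarrow> Y s = X (u s)"
    and X: "\<And>k. k \<in> K \<Longrightarrow> left_module R (X k)"
  shows "direct_sum_push K X S u \<in> lmod_hom R (lmod_direct_sum S Y) (lmod_direct_sum K X)"
proof (rule lmod_homI)
  note mon = abelian_group.axioms(1)[OF left_module.axioms(2)[OF X]]
  note simps = abelian_monoid.zero_closed[OF mon] abelian_monoid.l_zero[OF mon]
    left_module_smult_zero[OF X]
  have uS: "inv_into S u k \<in> S" "u (inv_into S u k) = k" if "k \<in> u ` S" for k
    using that by (auto intro: inv_into_into f_inv_into_f)
  have Y': "Y (inv_into S u k) = X k" if "k \<in> u ` S" for k using uS[OF that] Y by metis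
  {
    fix x assume x: "x \<in> carrier (lmod_direct_sum S Y)"
    have "{k \<in> K. direct_sum_push K X S u x k \<noteq> \<zero>\<^bsub>X k\<^esub>} \<subseteq> u ` {s \<in> S. x s \<noteq> \<zero>\<^bsub>Y s\<^esub>}"
      using u by (auto simp: direct_sum_push_def Y split: if_splits)
    then have "finite {k \<in> K. direct_sum_push K X S u x k \<noteq> \<zero>\<^bsub>X k\<^esub>}"
      using direct_sum_memD(3)[OF x] finite_surj by blast
    moreover have "direct_sum_push K X S u x k \<in> carrier (X k)" if "k \<in> K" for k
      using that direct_sum_memD(2)[OF x uS(1)[of k]] Y'[of k] by (auto simp: direct_sum_push_def simps)
    ultimately show "direct_sum_push K X S u x \<in> carrier (lmod_direct_sum K X)"
      by (auto simp: lmod_direct_sum_def PiE_iff direct_sum_push_def)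
  }
  fix x y assume "x \<in> carrier (lmod_direct_sum S Y)" "y \<in> carrier (lmod_direct_sum S Y)"
  show "direct_sum_push K X S u (x \<oplus>\<^bsub>lmod_direct_sum S Y\<^esub> y) =
      direct_sum_push K X S u x \<oplus>\<^bsub>lmod_direct_sum K X\<^esub> direct_sum_push K X S u y"
    by (rule ext) (auto simp: lmod_direct_sum_def direct_sum_push_def simps uS(1) Y' inv_into_into)
next
  fix a x assume "a \<in> carrier R" "x \<in> carrier (lmod_direct_sum S Y)"
  then show "direct_sum_push K X S u (a \<odot>\<^bsub>lmod_direct_sum S Y\<^esub> x) =
      a \<odot>\<^bsub>lmod_direct_sum K X\<^esub> direct_sum_push K X S u x"
    using u Y left_module_smult_zero[OF X]
    by (auto simp: lmod_direct_sum_def direct_sum_push_def fun_eq_iff)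
qed

lemma direct_sum_pull_push:
  assumes "inj_on u S" "u ` S \<subseteq> K" "x \<in> extensional S"
  shows "direct_sum_pull S u (direct_sum_push K X S u x) = x"
proof
  fix s show "direct_sum_pull S u (direct_sum_push K X S u x) s = x s"
    using direct_sum_push_apply[OF assms(1,2), of s X x] extensional_arb[OF assms(3), of s]
    by (simp add: direct_sum_pull_def)
qed

definition direct_sum_single ::
  "'k set \<Rightarrow> ('k \<Rightarrow> ('r, 'x, 'q) module_scheme) \<Rightarrow> 'k \<Rightarrow> 'x \<Rightarrow> 'k \<Rightarrow> 'x"
  where "direct_sum_single K X i x = (\<lambda>k\<in>K. if k = i then x else \<zero>\<^bsub>X k\<^esub>)"

lemma direct_sum_single_hom:
  assumes X: "\<And>k. k \<in> K \<Longrightarrow> left_module R (X k)" and i: "i \<in> K"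
  shows "direct_sum_single K X i \<in> lmod_hom R (X i) (lmod_direct_sum K X)"
proof (rule lmod_homI)
  note mon = abelian_group.axioms(1)[OF left_module.axioms(2)[OF X]]
  note simps = abelian_monoid.zero_closed[OF mon] abelian_monoid.l_zero[OF mon]
    left_module_smult_zero[OF X]
  fix x assume "x \<in> carrier (X i)"
  moreover have "finite {k \<in> K. direct_sum_single K X i x k \<noteq> \<zero>\<^bsub>X k\<^esub>}"
    by (rule finite_subset[of _ "{i}"]) (auto simp: direct_sum_single_def)
  ultimately show "direct_sum_single K X i x \<in> carrier (lmod_direct_sum K X)"
    by (auto simp: lmod_direct_sum_def direct_sum_single_def simps)
next
  note mon = abelian_group.axioms(1)[OF left_module.axioms(2)[OF X]]
  fix x y
  show "direct_sum_single K X i (x \<oplus>\<^bsub>X i\<^esub> y) =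
      direct_sum_single K X i x \<oplus>\<^bsub>lmod_direct_sum K X\<^esub> direct_sum_single K X i y"
    by (auto simp: lmod_direct_sum_def direct_sum_single_def fun_eq_iff
        abelian_monoid.zero_closed[OF mon] abelian_monoid.l_zero[OF mon])
next
  fix a x assume "a \<in> carrier R"
  then show "direct_sum_single K X i (a \<odot>\<^bsub>X i\<^esub> x) =
      a \<odot>\<^bsub>lmod_direct_sum K X\<^esub> direct_sum_single K X i x"
    by (auto simp: lmod_direct_sum_def direct_sum_single_def fun_eq_iff left_module_smult_zero[OF X])
qed

section \<open>Extending independent families of bricks\<close>

text \<open>
  Only two properties of the codomain enter: it is separated by homomorphisms into the \<open>G j\<close>, and
  every nonzero homomorphism from a summand \<open>X k\<close> to some \<open>G j\<close> is bijective.
\<close>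

locale schur_map =
  N: left_module R N
  for R :: "('r, 'p) ring_scheme" and N :: "('r, 'n, 's) module_scheme" +
  fixes K :: "'k set" and X :: "'k \<Rightarrow> ('r, 'x, 'a) module_scheme"
    and J :: "'j set" and G :: "'j \<Rightarrow> ('r, 'y, 'b) module_scheme"
    and q :: "'j \<Rightarrow> 'n \<Rightarrow> 'y" and g :: "('k \<Rightarrow> 'x) \<Rightarrow> 'n"
  assumes X_module: "\<And>k. k \<in> K \<Longrightarrow> left_module R (X k)"
    and G_module: "\<And>j. j \<in> J \<Longrightarrow> left_module R (G j)"
    and X_nontrivial: "\<And>k. k \<in> K \<Longrightarrow> \<exists>x\<in>carrier (X k). x \<noteq> \<zero>\<^bsub>X k\<^esub>"
    and schur: "\<And>k j h x. k \<in> K \<Longrightarrow> j \<in> J \<Longrightarrow> h \<in> lmod_hom R (X k) (G j) \<Longrightarrow>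
      x \<in> carrier (X k) \<Longrightarrow> h x \<noteq> \<zero>\<^bsub>G j\<^esub> \<Longrightarrow> bij_betw h (carrier (X k)) (carrier (G j))"
    and q_hom: "\<And>j. j \<in> J \<Longrightarrow> q j \<in> lmod_hom R N (G j)"
    and q_separates: "\<And>y. y \<in> carrier N \<Longrightarrow> (\<And>j. j \<in> J \<Longrightarrow> q j y = \<zero>\<^bsub>G j\<^esub>) \<Longrightarrow> y = \<zero>\<^bsub>N\<^esub>"
    and g_hom: "g \<in> lmod_hom R (lmod_direct_sum K X) N"
begin

abbreviation P where "P \<equiv> lmod_direct_sum K X"

sublocale P: left_module R P
  by (rule left_module_direct_sum[OF N.R.ring_axioms X_module])

abbreviation \<iota> where "\<iota> \<equiv> direct_sum_single K X"

text \<open>The partial sum over \<open>A\<close> is kept inside the carrier of \<open>P\<close>, so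
  that partial sums for different index sets are compared by inclusion and share one map
  \<open>g\<close>.\<close>

definition sub :: "'k set \<Rightarrow> ('k \<Rightarrow> 'x) set"
  where "sub A = {x \<in> carrier P. \<forall>k\<in>K - A. x k = \<zero>\<^bsub>X k\<^esub>}"

text \<open>This is injectivity of \<open>g\<close> on the partial sum over \<open>A\<close>, the
  analogue of linear independence of the images of basis vectors.\<close>

definition indep :: "'k set \<Rightarrow> bool"
  where "indep A \<longleftrightarrow> (\<forall>x\<in>sub A. g x = \<zero>\<^bsub>N\<^esub> \<longrightarrow> x = \<zero>\<^bsub>P\<^esub>)"

text \<open>This expresses that the block of \<open>g\<close> with columns \<open>A\<close> and rows
  \<open>B\<close> is invertible: the system for the coordinates in \<open>B\<close> is solvable for
  every right-hand side coming from \<open>N\<close>, and its homogeneous form has only the zero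
  solution.\<close>

definition pivots :: "'k set \<Rightarrow> 'j set \<Rightarrow> bool"
  where "pivots A B \<longleftrightarrow> B \<subseteq> J \<and>
    (\<forall>y\<in>carrier N. \<exists>x\<in>sub A. \<forall>b\<in>B. q b (g x) = q b y) \<and>
    (\<forall>x\<in>sub A. (\<forall>b\<in>B. q b (g x) = \<zero>\<^bsub>G b\<^esub>) \<longrightarrow> x = \<zero>\<^bsub>P\<^esub>)"

section \<open>Calculus of partial sums\<close>

lemma sub_closed: "x \<in> sub A \<Longrightarrow> x \<in> carrier P"
  by (simp add: sub_def)

lemma sub_mono: "A \<subseteq> B \<Longrightarrow> sub A \<subseteq> sub B"
  by (auto simp: sub_def)

lemma indep_mono: "A \<subseteq> B \<Longrightarrow> indep B \<Longrightarrow> indep A"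
  using sub_mono[of A B] by (auto simp: indep_def)

lemma g_closed: "x \<in> carrier P \<Longrightarrow> g x \<in> carrier N"
  by (rule lmod_hom_closed[OF g_hom])

lemma \<iota>_closed: "i \<in> K \<Longrightarrow> u \<in> carrier (X i) \<Longrightarrow> \<iota> i u \<in> carrier P"
  by (rule lmod_hom_closed[OF direct_sum_single_hom[OF X_module]])

lemma sub_zero: "\<zero>\<^bsub>P\<^esub> \<in> sub A"
  by (simp add: sub_def direct_sum_zero)

lemma sub_add:
  assumes "x \<in> sub A" "y \<in> sub A"
  shows "x \<oplus>\<^bsub>P\<^esub> y \<in> sub A"
proof -
  have "(x \<oplus>\<^bsub>P\<^esub> y) k = \<zero>\<^bsub>X k\<^esub>" if k: "k \<in> K - A" for k
  proof -
    interpret X: left_module R "X k" using X_module k by blast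
    show ?thesis using lmod_hom_add[OF direct_sum_component_hom, of k K x X y] assms k
      by (auto simp: sub_def)
  qed
  then show ?thesis using assms by (auto simp: sub_def)
qed

lemma sub_smult:
  assumes "a \<in> carrier R" "x \<in> sub A"
  shows "a \<odot>\<^bsub>P\<^esub> x \<in> sub A"
  using assms lmod_hom_smult[OF direct_sum_component_hom, of _ K a R x X]
    left_module_smult_zero[OF X_module] by (auto simp: sub_def)

lemma component_diff:
  assumes "k \<in> K" "x \<in> carrier P" "y \<in> carrier P"
  shows "(x \<ominus>\<^bsub>P\<^esub> y) k = x k \<ominus>\<^bsub>X k\<^esub> y k"
  using lmod_hom_diff[OF P.left_module_axioms X_module[OF assms(1)] direct_sum_component_hom] assms
  by blast

lemma sub_diff:
  assumes "x \<in> sub A" "y \<in> sub A"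
  shows "x \<ominus>\<^bsub>P\<^esub> y \<in> sub A"
proof -
  have "(x \<ominus>\<^bsub>P\<^esub> y) k = \<zero>\<^bsub>X k\<^esub>" if k: "k \<in> K - A" for k
  proof -
    interpret X: left_module R "X k" using X_module k by blast
    show ?thesis using component_diff[of k x y] assms k by (auto simp: sub_def X.M.minus_eq)
  qed
  then show ?thesis using assms by (auto simp: sub_def)
qed

lemma \<iota>_sub: "i \<in> K \<Longrightarrow> i \<in> A \<Longrightarrow> u \<in> carrier (X i) \<Longrightarrow> \<iota> i u \<in> sub A"
  using \<iota>_closed by (auto simp: sub_def direct_sum_single_def)

text \<open>Splitting off one component is the means by which an index is added to \<open>A\<close>,
  both in the elimination step and in the spanning argument.\<close>

lemma sub_insert_diff:
  assumes i: "i \<in> K" and x: "x \<in> sub (insert i A)"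
  shows "x \<ominus>\<^bsub>P\<^esub> \<iota> i (x i) \<in> sub A"
proof -
  have xP: "x \<in> carrier P" using x by (rule sub_closed)
  have xi: "\<iota> i (x i) \<in> carrier P" using \<iota>_closed[OF i] direct_sum_memD(2)[OF xP i] .
  have "(x \<ominus>\<^bsub>P\<^esub> \<iota> i (x i)) k = \<zero>\<^bsub>X k\<^esub>" if k: "k \<in> K - A" for k
  proof -
    interpret X: left_module R "X k" using X_module k by blast
    have "x k \<in> carrier (X k)" using direct_sum_memD(2)[OF xP] k by blast
    then have "x k \<ominus>\<^bsub>X k\<^esub> x k = \<zero>\<^bsub>X k\<^esub>" by (rule X.M.minus_self)
    then show ?thesis using component_diff[OF _ xP xi, of k] k x
      by (cases "k = i") (auto simp: direct_sum_single_def sub_def)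
  qed
  then show ?thesis using xP xi by (auto simp: sub_def)
qed

lemma diff_add_cancel:
  assumes "x \<in> carrier P" "y \<in> carrier P"
  shows "(x \<ominus>\<^bsub>P\<^esub> y) \<oplus>\<^bsub>P\<^esub> y = x"
  using assms by (simp add: P.M.minus_eq P.M.a_assoc P.M.l_neg)

lemma sub_support: "x \<in> carrier P \<Longrightarrow> x \<in> sub {k \<in> K. x k \<noteq> \<zero>\<^bsub>X k\<^esub>}"
  by (auto simp: sub_def)

section \<open>Elimination, spanning and extension to a basis\<close>

lemma pivots_indep:
  assumes "pivots A B"
  shows "indep A"
  unfolding indep_def
proof (intro ballI impI)
  fix x assume x: "x \<in> sub A" "g x = \<zero>\<^bsub>N\<^esub>"
  have "q b (g x) = \<zero>\<^bsub>G b\<^esub>" if "b \<in> B" for b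
  proof -
    have "b \<in> J" using that assms by (auto simp: pivots_def)
    then show ?thesis
      using x(2) lmod_hom_zero[OF N.left_module_axioms G_module q_hom] by simp
  qed
  then show "x = \<zero>\<^bsub>P\<^esub>" using assms x(1) by (auto simp: pivots_def)
qed

text \<open>Choose for each \<open>y\<close> a solution of the system with invertible block. The
  solution is unique, and this makes the choice linear. Then \<open>g\<close> after \<open>s\<close>
  is the projection of \<open>N\<close> onto the image of \<open>sub A\<close> along the elements
  whose coordinates in \<open>B\<close> vanish.\<close>

lemma pivots_section:
  assumes "pivots A B"
  obtains s where "s \<in> lmod_hom R N P" "\<And>y. y \<in> carrier N \<Longrightarrow> s y \<in> sub A"
    "\<And>y b. y \<in> carrier N \<Longrightarrow> b \<in> B \<Longrightarrow> q b (g (s y)) = q b y"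
    "\<And>x y. x \<in> sub A \<Longrightarrow> y \<in> carrier N \<Longrightarrow> (\<And>b. b \<in> B \<Longrightarrow> q b (g x) = q b y) \<Longrightarrow> x = s y"
proof -
  have BJ: "B \<subseteq> J" using assms by (simp add: pivots_def)
  have "\<forall>y. \<exists>x. y \<in> carrier N \<longrightarrow> x \<in> sub A \<and> (\<forall>b\<in>B. q b (g x) = q b y)"
    using assms unfolding pivots_def by blast
  then obtain s where s: "\<And>y. y \<in> carrier N \<Longrightarrow> s y \<in> sub A"
    "\<And>y b. y \<in> carrier N \<Longrightarrow> b \<in> B \<Longrightarrow> q b (g (s y)) = q b y" by metis
  have qg: "(\<lambda>x. q b (g x)) \<in> lmod_hom R P (G b)" if "b \<in> B" for b
    using lmod_hom_compose[OF g_hom q_hom] that BJ by blast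
  have uniq: "x = s y" if x: "x \<in> sub A" and y: "y \<in> carrier N"
    and eq: "\<And>b. b \<in> B \<Longrightarrow> q b (g x) = q b y" for x y
  proof -
    have "q b (g (x \<ominus>\<^bsub>P\<^esub> s y)) = \<zero>\<^bsub>G b\<^esub>" if b: "b \<in> B" for b
    proof -
      interpret G: left_module R "G b" using G_module b BJ by blast
      have "q b y \<in> carrier (G b)" using lmod_hom_closed[OF q_hom] b BJ y by blast
      then show ?thesis
        using lmod_hom_diff[OF P.left_module_axioms G.left_module_axioms qg[OF b],
            OF sub_closed[OF x] sub_closed[OF s(1)[OF y]]] s(2)[OF y b] eq[OF b]
        by (simp add: G.M.minus_self)
    qed
    then have "x \<ominus>\<^bsub>P\<^esub> s y = \<zero>\<^bsub>P\<^esub>"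
      using assms sub_diff[OF x s(1)[OF y]] unfolding pivots_def by blast
    then show ?thesis using P.M.minus_eq_zeroD sub_closed[OF x] sub_closed[OF s(1)[OF y]] by blast
  qed
  have "s \<in> lmod_hom R N P"
  proof (rule lmod_homI)
    fix x y assume xy: "x \<in> carrier N" "y \<in> carrier N"
    have "q b (g (s x \<oplus>\<^bsub>P\<^esub> s y)) = q b (x \<oplus>\<^bsub>N\<^esub> y)" if b: "b \<in> B" for b
      using lmod_hom_add[OF qg[OF b], of "s x" "s y"] lmod_hom_add[OF q_hom, of b x y]
        b BJ xy s(2) sub_closed[OF s(1)] by auto
    then show "s (x \<oplus>\<^bsub>N\<^esub> y) = s x \<oplus>\<^bsub>P\<^esub> s y"
      using uniq[OF sub_add[OF s(1) s(1)], of x y "x \<oplus>\<^bsub>N\<^esub> y"] xy by simp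
  next
    fix a x assume ax: "a \<in> carrier R" "x \<in> carrier N"
    have "q b (g (a \<odot>\<^bsub>P\<^esub> s x)) = q b (a \<odot>\<^bsub>N\<^esub> x)" if b: "b \<in> B" for b
      using lmod_hom_smult[OF qg[OF b], of a "s x"] lmod_hom_smult[OF q_hom, of b a x]
        b BJ ax s(2) sub_closed[OF s(1)] by auto
    then show "s (a \<odot>\<^bsub>N\<^esub> x) = a \<odot>\<^bsub>P\<^esub> s x"
      using uniq[OF sub_smult[OF _ s(1)], of a x "a \<odot>\<^bsub>N\<^esub> x"] ax by simp
  qed (use s(1) sub_closed in blast)
  then show ?thesis using that s uniq by blast
qed

text \<open>
  Clearing the coordinates in \<open>B\<close> leaves a homomorphism from \<open>X i\<close>
  to \<open>N\<close>, and any of its nonzero components serves as the new pivot.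
\<close>

lemma pivots_step:
  assumes piv: "pivots A B" and i: "i \<in> K"
  shows "(\<forall>u\<in>carrier (X i). g (\<iota> i u) \<in> g ` sub A) \<or> (\<exists>j. pivots (insert i A) (insert j B))"
proof -
  interpret Xi: left_module R "X i" using X_module[OF i] .
  have BJ: "B \<subseteq> J" using piv by (simp add: pivots_def)
  obtain s where s: "s \<in> lmod_hom R N P" "\<And>y. y \<in> carrier N \<Longrightarrow> s y \<in> sub A"
    "\<And>y b. y \<in> carrier N \<Longrightarrow> b \<in> B \<Longrightarrow> q b (g (s y)) = q b y"
    "\<And>x y. x \<in> sub A \<Longrightarrow> y \<in> carrier N \<Longrightarrow> (\<And>b. b \<in> B \<Longrightarrow> q b (g x) = q b y) \<Longrightarrow> x = s y"
    using pivots_section[OF piv] by metis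
  \<comment> \<open>Column operation: subtract from the element of the new summand the element of
    \<open>sub A\<close> whose image has the same coordinates in \<open>B\<close>.\<close>
  define e where "e u = \<iota> i u \<ominus>\<^bsub>P\<^esub> s (g (\<iota> i u))" for u
  have \<iota>g: "(\<lambda>u. g (\<iota> i u)) \<in> lmod_hom R (X i) N"
    by (rule lmod_hom_compose[OF direct_sum_single_hom[OF X_module i] g_hom])
  have e: "e \<in> lmod_hom R (X i) P"
    unfolding e_def
    by (intro lmod_hom_minus P.left_module_axioms Xi.left_module_axioms
        direct_sum_single_hom[OF X_module i] lmod_hom_compose[OF \<iota>g s(1)])
  have eP: "e u \<in> carrier P" if "u \<in> carrier (X i)" for u using lmod_hom_closed[OF e that] .
  have esub: "e u \<in> sub (insert i A)" if "u \<in> carrier (X i)" for u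
    unfolding e_def using that sub_mono[of A "insert i A"] s(2) g_closed \<iota>_closed[OF i that]
    by (intro sub_diff \<iota>_sub[OF i]) auto
  have qge: "(\<lambda>u. q j (g (e u))) \<in> lmod_hom R (X i) (G j)" if "j \<in> J" for j
    using lmod_hom_compose[OF lmod_hom_compose[OF e g_hom] q_hom[OF that]] .
  have qge_B: "q b (g (e u)) = \<zero>\<^bsub>G b\<^esub>" if u: "u \<in> carrier (X i)" and b: "b \<in> B" for u b
  proof -
    interpret G: left_module R "G b" using G_module b BJ by blast
    have bJ: "b \<in> J" using b BJ by blast
    note c = \<iota>_closed[OF i u] g_closed[OF \<iota>_closed[OF i u]]
    have "q b (g (e u)) = q b (g (\<iota> i u)) \<ominus>\<^bsub>G b\<^esub> q b (g (s (g (\<iota> i u))))"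
      unfolding e_def
      using lmod_hom_diff[OF P.left_module_axioms G.left_module_axioms lmod_hom_compose[OF g_hom q_hom[OF bJ]]
          c(1) sub_closed[OF s(2)[OF c(2)]]] .
    then show ?thesis
      using s(3)[OF c(2) b] lmod_hom_closed[OF q_hom[OF bJ] c(2)] by (simp add: G.M.minus_self)
  qed
  have g\<iota>: "g (\<iota> i u) = g (e u) \<oplus>\<^bsub>N\<^esub> g (s (g (\<iota> i u)))" if u: "u \<in> carrier (X i)" for u
  proof -
    note c = \<iota>_closed[OF i u] sub_closed[OF s(2)[OF g_closed[OF \<iota>_closed[OF i u]]]]
    show ?thesis
      using lmod_hom_add[OF g_hom eP[OF u] c(2)] diff_add_cancel[OF c] by (simp add: e_def)
  qed
  show ?thesis
  proof (cases "\<forall>j\<in>J. \<forall>u\<in>carrier (X i). q j (g (e u)) = \<zero>\<^bsub>G j\<^esub>")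
    \<comment> \<open>All coordinates of \<open>g (e u)\<close> vanish, so it is zero by
      \<open>q_separates\<close>, and the image of the new summand is attained by \<open>s\<close>
      inside \<open>sub A\<close>.\<close>
    case True
    have "g (\<iota> i u) \<in> g ` sub A" if u: "u \<in> carrier (X i)" for u
    proof -
      have "g (e u) = \<zero>\<^bsub>N\<^esub>" using True u q_separates g_closed[OF eP[OF u]] by blast
      moreover have "s (g (\<iota> i u)) \<in> sub A" using s(2) g_closed \<iota>_closed[OF i u] by blast
      ultimately show ?thesis using g\<iota>[OF u] g_closed[OF sub_closed] by auto
    qed
    then show ?thesis by blast
  next
    case False
    then obtain j u0 where j: "j \<in> J" and u0: "u0 \<in> carrier (X i)" "q j (g (e u0)) \<noteq> \<zero>\<^bsub>G j\<^esub>" by blast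
    interpret Gj: left_module R "G j" using G_module[OF j] .
    have bij: "bij_betw (\<lambda>u. q j (g (e u))) (carrier (X i)) (carrier (G j))"
      using schur[OF i j qge[OF j] u0] .
    have "pivots (insert i A) (insert j B)"
      unfolding pivots_def
    proof (intro conjI ballI impI)
      show "insert j B \<subseteq> J" using j BJ by blast
    next
      fix y assume y: "y \<in> carrier N"
      note sy = s(2)[OF y] sub_closed[OF s(2)[OF y]]
      note c = lmod_hom_closed[OF q_hom[OF j] y] lmod_hom_closed[OF q_hom[OF j] g_closed[OF sy(2)]]
      \<comment> \<open>\<open>s y\<close> already has the right coordinates in \<open>B\<close>.
        The error at \<open>j\<close> is corrected by some \<open>e u\<close>, because the new
        component is bijective; this leaves \<open>B\<close> unchanged, as \<open>g (e u)\<close>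
        vanishes there.\<close>
      have "q j y \<ominus>\<^bsub>G j\<^esub> q j (g (s y)) \<in> (\<lambda>u. q j (g (e u))) ` carrier (X i)"
        using bij_betw_imp_surj_on[OF bij] Gj.M.minus_closed[OF c] by simp
      then obtain u where u: "u \<in> carrier (X i)" "q j (g (e u)) = q j y \<ominus>\<^bsub>G j\<^esub> q j (g (s y))"
        by auto
      have qgx: "q b (g (e u \<oplus>\<^bsub>P\<^esub> s y)) = q b (g (e u)) \<oplus>\<^bsub>G b\<^esub> q b (g (s y))" if "b \<in> J" for b
        using lmod_hom_add[OF lmod_hom_compose[OF g_hom q_hom[OF that]] eP[OF u(1)] sy(2)] .
      have "q b (g (e u \<oplus>\<^bsub>P\<^esub> s y)) = q b y" if b: "b \<in> insert j B" for b
      proof (cases "b \<in> B")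
        case True
        then have bJ: "b \<in> J" using BJ by blast
        interpret G: left_module R "G b" using G_module[OF bJ] .
        show ?thesis
          using qgx[OF bJ] qge_B[OF u(1) True] s(3)[OF y True] lmod_hom_closed[OF q_hom[OF bJ] y] by simp
      next
        case False
        then show ?thesis
          using b qgx[OF j] u(2) c by (simp add: Gj.M.minus_eq Gj.M.a_assoc Gj.M.l_neg)
      qed
      moreover have "e u \<oplus>\<^bsub>P\<^esub> s y \<in> sub (insert i A)"
        using sub_add esub[OF u(1)] sy(1) sub_mono[of A "insert i A"] by blast
      ultimately show "\<exists>x\<in>sub (insert i A). \<forall>b\<in>insert j B. q b (g x) = q b y" by blast
    next
      fix x assume x: "x \<in> sub (insert i A)" and z: "\<forall>b\<in>insert j B. q b (g x) = \<zero>\<^bsub>G b\<^esub>"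
      have xP: "x \<in> carrier P" using sub_closed[OF x] .
      have xi: "x i \<in> carrier (X i)" using direct_sum_memD(2)[OF xP i] .
      \<comment> \<open>Reducing \<open>x\<close> by the new column leaves \<open>a\<close> in
        \<open>sub A\<close> with vanishing coordinates in \<open>B\<close>, so \<open>a\<close> is
        zero by the old pivots. Hence \<open>x = e (x i)\<close>, and injectivity at the new pivot
        \<open>j\<close> forces \<open>x i\<close> to be zero.\<close>
      define a where "a = x \<ominus>\<^bsub>P\<^esub> e (x i)"
      note c = \<iota>_closed[OF i xi] sub_closed[OF s(2)[OF g_closed[OF \<iota>_closed[OF i xi]]]]
      have a: "a \<in> carrier P" using xP eP[OF xi] by (simp add: a_def)
      have "a = (x \<ominus>\<^bsub>P\<^esub> \<iota> i (x i)) \<oplus>\<^bsub>P\<^esub> s (g (\<iota> i (x i)))"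
        unfolding a_def e_def using xP c
        by (simp add: P.M.minus_eq P.M.minus_add P.M.minus_minus P.M.a_assoc)
      then have asub: "a \<in> sub A"
        using sub_add sub_insert_diff[OF i x] s(2)[OF g_closed[OF c(1)]] by simp
      have qga: "q b (g a) = q b (g x) \<ominus>\<^bsub>G b\<^esub> q b (g (e (x i)))" if "b \<in> J" for b
        unfolding a_def using lmod_hom_diff[OF P.left_module_axioms G_module[OF that]
            lmod_hom_compose[OF g_hom q_hom[OF that]] xP eP[OF xi]] .
      have "q b (g a) = \<zero>\<^bsub>G b\<^esub>" if b: "b \<in> B" for b
      proof -
        have bJ: "b \<in> J" using b BJ by blast
        interpret G: left_module R "G b" using G_module[OF bJ] .
        show ?thesis using qga[OF bJ] z b qge_B[OF xi b] by (simp add: G.M.minus_eq)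
      qed
      then have "a = \<zero>\<^bsub>P\<^esub>" using piv asub unfolding pivots_def by blast
      then have xe: "x = e (x i)" using P.M.minus_eq_zeroD[OF xP eP[OF xi]] by (simp add: a_def)
      then have "q j (g (e (x i))) = q j (g (e \<zero>\<^bsub>X i\<^esub>))"
        using z lmod_hom_zero[OF Xi.left_module_axioms Gj.left_module_axioms qge[OF j]] by simp
      then have "x i = \<zero>\<^bsub>X i\<^esub>" using bij xi by (auto simp: bij_betw_def dest: inj_onD)
      then show "x = \<zero>\<^bsub>P\<^esub>"
        using xe lmod_hom_zero[OF Xi.left_module_axioms P.left_module_axioms e] by simp
    qed
    then show ?thesis by blast
  qed
qed

text \<open>Otherwise a nonzero \<open>u\<close> and some \<open>t\<close> in \<open>sub A\<close>
  have the same image, and the difference is a relation over \<open>insert i A\<close> whose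
  component at \<open>i\<close> is \<open>u\<close>. This excludes the first alternative of
  \<open>pivots_step\<close>.\<close>

lemma indep_insert_not_spanned:
  assumes "indep (insert i A)" "i \<in> K" "i \<notin> A"
  shows "\<exists>u\<in>carrier (X i). g (\<iota> i u) \<notin> g ` sub A"
proof (rule ccontr)
  assume *: "\<not> ?thesis"
  obtain u where u: "u \<in> carrier (X i)" "u \<noteq> \<zero>\<^bsub>X i\<^esub>" using X_nontrivial[OF assms(2)] by blast
  interpret Xi: left_module R "X i" using X_module[OF assms(2)] .
  obtain t where t: "t \<in> sub A" "g (\<iota> i u) = g t" using * u(1) by blast
  note c = \<iota>_closed[OF assms(2) u(1)] sub_closed[OF t(1)]
  have "g (\<iota> i u \<ominus>\<^bsub>P\<^esub> t) = \<zero>\<^bsub>N\<^esub>"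
    using lmod_hom_diff[OF P.left_module_axioms N.left_module_axioms g_hom c] t(2) g_closed[OF c(2)]
    by (simp add: N.M.minus_self)
  moreover have "\<iota> i u \<ominus>\<^bsub>P\<^esub> t \<in> sub (insert i A)"
    using sub_mono[of A "insert i A"] t(1) u(1) assms(2) by (intro sub_diff \<iota>_sub) auto
  ultimately have "\<iota> i u \<ominus>\<^bsub>P\<^esub> t = \<zero>\<^bsub>P\<^esub>" using assms(1) by (simp add: indep_def)
  then have "\<iota> i u = t" using P.M.minus_eq_zeroD c by blast
  moreover have "t i = \<zero>\<^bsub>X i\<^esub>" using t(1) assms(2,3) by (simp add: sub_def)
  ultimately show False using u(2) assms(2) by (auto simp: direct_sum_single_def)
qed

lemma sub_empty: "sub {} = {\<zero>\<^bsub>P\<^esub>}"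
  using direct_sum_eqI[of _ K X "\<zero>\<^bsub>P\<^esub>"] sub_zero by (auto simp: sub_def direct_sum_zero)

text \<open>Gaussian elimination one index at a time: by independence every step of the induction
  takes the second alternative of \<open>pivots_step\<close> and yields a further pivot.\<close>

lemma indep_pivots:
  assumes "finite A" "A \<subseteq> K" "indep A"
  shows "\<exists>B. pivots A B"
  using assms
proof (induction A)
  case empty
  have "pivots {} {}" by (auto simp: pivots_def sub_empty)
  then show ?case by blast
next
  case (insert i A)
  then obtain B where B: "pivots A B" using indep_mono[of A "insert i A"] by blast
  then show ?case using pivots_step[OF B, of i] indep_insert_not_spanned[of i A] insert by blast
qed

text \<open>Pivots for \<open>insert i A\<close> would make that set independent, so only the first
  alternative of \<open>pivots_step\<close> remains.\<close>

lemma finite_dependent_spanned: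
  assumes "finite A" "A \<subseteq> K" "indep A" "i \<in> K" "\<not> indep (insert i A)" "u \<in> carrier (X i)"
  shows "g (\<iota> i u) \<in> g ` sub A"
proof -
  obtain B where B: "pivots A B" using indep_pivots assms by blast
  then show ?thesis using pivots_step[OF B assms(4)] pivots_indep assms by blast
qed

text \<open>A relation has finite support, so dependence on \<open>T\<close> is already dependence
  on a finite subset of \<open>T\<close>, where elimination is available.\<close>

lemma dependent_spanned:
  assumes "T \<subseteq> K" "indep T" "i \<in> K" "\<not> indep (insert i T)" "u \<in> carrier (X i)"
  shows "g (\<iota> i u) \<in> g ` sub T"
proof -
  obtain x where x: "x \<in> sub (insert i T)" "g x = \<zero>\<^bsub>N\<^esub>" "x \<noteq> \<zero>\<^bsub>P\<^esub>"
    using assms(4) by (auto simp: indep_def)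
  \<comment> \<open>\<open>A\<close> consists of the indices other than \<open>i\<close> that occur
    in the relation \<open>x\<close>.\<close>
  define A where "A = {k \<in> K. x k \<noteq> \<zero>\<^bsub>X k\<^esub>} - {i}"
  have A: "finite A" "A \<subseteq> T"
    using direct_sum_memD(3)[OF sub_closed[OF x(1)]] x(1) by (auto simp: A_def sub_def)
  have "x \<in> sub (insert i A)" using sub_closed[OF x(1)] by (auto simp: A_def sub_def)
  then have "\<not> indep (insert i A)" using x by (auto simp: indep_def)
  then have "g (\<iota> i u) \<in> g ` sub A"
    using A assms indep_mono[OF A(2)] by (intro finite_dependent_spanned) auto
  then show ?thesis using sub_mono[OF A(2)] by blast
qed

text \<open>Each element has finite support, so it suffices to treat finite subsets of
  \<open>K0\<close>; there the components are split off one by one.\<close>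

lemma image_sub_spanned:
  assumes TK: "T \<subseteq> K0" "K0 \<subseteq> K"
    and span: "\<And>i u. i \<in> K0 - T \<Longrightarrow> u \<in> carrier (X i) \<Longrightarrow> g (\<iota> i u) \<in> g ` sub T"
  shows "g ` sub K0 = g ` sub T"
proof
  show "g ` sub T \<subseteq> g ` sub K0" using sub_mono[OF TK(1)] by blast
  have fin: "\<forall>x\<in>sub A. g x \<in> g ` sub T" if "finite A" "A \<subseteq> K0" for A
    using that
  proof (induction A)
    case empty
    then show ?case using sub_mono[of "{}" T] by blast
  next
    case (insert i A)
    show ?case
    proof
      fix x assume x: "x \<in> sub (insert i A)"
      have i: "i \<in> K" using insert TK by blast
      have xi: "x i \<in> carrier (X i)" using direct_sum_memD(2)[OF sub_closed[OF x] i] .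
      let ?d = "x \<ominus>\<^bsub>P\<^esub> \<iota> i (x i)"
      have d: "?d \<in> sub A" using sub_insert_diff[OF i x] .
      obtain t where t: "t \<in> sub T" "g ?d = g t" using d insert by blast
      have "g (\<iota> i (x i)) \<in> g ` sub T"
        using span[of i "x i"] \<iota>_sub[OF i _ xi, of T] xi insert.prems by (cases "i \<in> T") auto
      then obtain t' where t': "t' \<in> sub T" "g (\<iota> i (x i)) = g t'" by blast
      have "g x = g ?d \<oplus>\<^bsub>N\<^esub> g (\<iota> i (x i))"
        using lmod_hom_add[OF g_hom sub_closed[OF d] \<iota>_closed[OF i xi]]
          diff_add_cancel[OF sub_closed[OF x] \<iota>_closed[OF i xi]] by simp
      then have "g x = g (t \<oplus>\<^bsub>P\<^esub> t')"
        using lmod_hom_add[OF g_hom sub_closed[OF t(1)] sub_closed[OF t'(1)]] t(2) t'(2) by simp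
      then show "g x \<in> g ` sub T" using sub_add[OF t(1) t'(1)] by blast
    qed
  qed
  show "g ` sub K0 \<subseteq> g ` sub T"
  proof (rule image_subsetI)
    fix x assume x: "x \<in> sub K0"
    then have "{k \<in> K. x k \<noteq> \<zero>\<^bsub>X k\<^esub>} \<subseteq> K0" by (auto simp: sub_def)
    then show "g x \<in> g ` sub T"
      using fin[OF direct_sum_memD(3)[OF sub_closed[OF x]]] sub_support[OF sub_closed[OF x]] by blast
  qed
qed

text \<open>Zorn's lemma gives a maximal independent \<open>T\<close> between \<open>T0\<close> and
  \<open>K0\<close>; by maximality each further index is dependent on \<open>T\<close>, hence
  spanned. The set \<open>T0\<close> allows a basis of a subspace to be prolonged to a larger
  \<open>K0\<close>.\<close>

lemma exists_basis_extension:
  assumes T0: "T0 \<subseteq> K0" "indep T0" and K0: "K0 \<subseteq> K"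
  obtains T where "T0 \<subseteq> T" "T \<subseteq> K0" "indep T" "g ` sub K0 = g ` sub T"
proof -
  define \<T> where "\<T> = {T. T0 \<subseteq> T \<and> T \<subseteq> K0 \<and> indep T}"
  have "\<exists>T\<in>\<T>. \<forall>T'\<in>\<T>. T \<subseteq> T' \<longrightarrow> T' = T"
  proof (rule subset_Zorn_nonempty)
    show "\<T> \<noteq> {}" using T0 by (auto simp: \<T>_def)
    fix \<C> assume ne: "\<C> \<noteq> {}" and ch: "subset.chain \<T> \<C>"
    have C: "T0 \<subseteq> T" "T \<subseteq> K0" "indep T" if "T \<in> \<C>" for T
      using ch that by (auto simp: subset.chain_def \<T>_def)
    have "indep (\<Union>\<C>)"
      unfolding indep_def
    proof (intro ballI impI)
      fix x assume x: "x \<in> sub (\<Union>\<C>)" "g x = \<zero>\<^bsub>N\<^esub>"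
      \<comment> \<open>The finite support of a relation over the union of the chain lies in a
        single member, which is independent.\<close>
      have "{k \<in> K. x k \<noteq> \<zero>\<^bsub>X k\<^esub>} \<subseteq> \<Union>\<C>" using x(1) by (auto simp: sub_def)
      then obtain T where T: "T \<in> \<C>" "{k \<in> K. x k \<noteq> \<zero>\<^bsub>X k\<^esub>} \<subseteq> T"
        using finite_subset_Union_chain[OF direct_sum_memD(3)[OF sub_closed[OF x(1)]] _ ne ch] by blast
      then have "x \<in> sub T" using sub_support[OF sub_closed[OF x(1)]] sub_mono by blast
      then show "x = \<zero>\<^bsub>P\<^esub>" using C(3)[OF T(1)] x(2) by (simp add: indep_def)
    qed
    then show "\<Union>\<C> \<in> \<T>" using ne C by (auto simp: \<T>_def)
  qed
  then obtain T where T: "T0 \<subseteq> T" "T \<subseteq> K0" "indep T"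
    and max: "\<And>T'. T' \<in> \<T> \<Longrightarrow> T \<subseteq> T' \<Longrightarrow> T' = T" by (auto simp: \<T>_def)
  have "g (\<iota> i u) \<in> g ` sub T" if i: "i \<in> K0 - T" and u: "u \<in> carrier (X i)" for i u
  proof (rule dependent_spanned[OF _ T(3) _ _ u])
    show "\<not> indep (insert i T)" using max[of "insert i T"] i T by (auto simp: \<T>_def)
  qed (use i T K0 in auto)
  then show ?thesis using that T image_sub_spanned[OF T(2) K0] by blast
qed

end

section \<open>Semibricks\<close>

lemma brick_left_module: "brick R X \<Longrightarrow> left_module R X"
  by (simp add: brick_def finitely_presented_def)

lemma brick_nontrivial:
  assumes "brick R X"
  shows "\<exists>x\<in>carrier X. x \<noteq> \<zero>\<^bsub>X\<^esub>"
proof (rule ccontr)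
  assume "\<not> ?thesis"
  then have "\<one>\<^bsub>lmod_End R X\<^esub> = \<zero>\<^bsub>lmod_End R X\<^esub>" by (auto simp: lmod_End_def fun_eq_iff)
  then show False using assms div_ring.one_not_zero by (auto simp: brick_def)
qed

text \<open>A nonzero endomorphism is a unit of the division ring, and its ring inverse is an
  inverse map on the carrier. Passing to the restriction \<open>e\<close> makes \<open>h\<close> an
  element of \<open>lmod_End\<close>, whose elements are extensional.\<close>

lemma brick_endo_bij:
  assumes X: "brick R X" and h: "h \<in> lmod_hom R X X" and x: "x \<in> carrier X" "h x \<noteq> \<zero>\<^bsub>X\<^esub>"
  shows "bij_betw h (carrier X) (carrier X)"
proof -
  interpret D: div_ring "lmod_End R X" using X by (simp add: brick_def)
  interpret left_module R X using brick_left_module[OF X] .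
  define e where "e = restrict h (carrier X)"
  have "e \<in> carrier (lmod_End R X)"
    using h by (auto simp: lmod_End_def lmod_hom_def e_def)
  moreover have "e \<noteq> \<zero>\<^bsub>lmod_End R X\<^esub>"
  proof
    assume "e = \<zero>\<^bsub>lmod_End R X\<^esub>"
    then have "e x = (\<lambda>x\<in>carrier X. \<zero>\<^bsub>X\<^esub>) x" by (simp add: lmod_End_def)
    then show False using x by (simp add: e_def)
  qed
  ultimately have "e \<in> Units (lmod_End R X)" using D.Units_eq by blast
  then obtain k where k: "k \<in> carrier (lmod_End R X)"
    "k \<otimes>\<^bsub>lmod_End R X\<^esub> e = \<one>\<^bsub>lmod_End R X\<^esub>" "e \<otimes>\<^bsub>lmod_End R X\<^esub> k = \<one>\<^bsub>lmod_End R X\<^esub>"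
    unfolding Units_def by blast
  have kc: "k \<in> carrier X \<rightarrow> carrier X" using k(1) by (auto simp: lmod_End_def lmod_hom_def)
  have hc: "h \<in> carrier X \<rightarrow> carrier X" using h by (auto simp: lmod_hom_def)
  show ?thesis
  proof (rule bij_betwI[OF hc kc])
    show "k (h y) = y" if "y \<in> carrier X" for y
      using fun_cong[OF k(2), of y] that by (simp add: lmod_End_def compose_def e_def)
    show "h (k y) = y" if "y \<in> carrier X" for y
      using fun_cong[OF k(3), of y] that funcset_mem[OF kc that]
      by (simp add: lmod_End_def compose_def e_def)
  qed
qed

text \<open>Schur's lemma for semibricks: homomorphisms between distinct members vanish, so a
  nonzero one is an endomorphism of a brick.\<close>

lemma semibrick_hom_bij:
  assumes "semibrick R \<X>" "X \<in> \<X>" "Y \<in> \<X>" "h \<in> lmod_hom R X Y" "x \<in> carrier X" "h x \<noteq> \<zero>\<^bsub>Y\<^esub>"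
  shows "bij_betw h (carrier X) (carrier Y)"
proof -
  have XY: "X = Y" using assms unfolding semibrick_def by blast
  have "brick R X" using assms(1,2) by (simp add: semibrick_def)
  from brick_endo_bij[OF this, of h x] show ?thesis using assms(4-6) by (simp add: XY)
qed

theorem proposition3p6:
  fixes R :: "('r, 'p) ring_scheme"
    and \<X> :: "('r, 'x) module set"
    and M :: "('r, 'm) module"
    and N :: "('r, 'n) module"
    and f :: "'m \<Rightarrow> 'n"
  assumes "ring R"
    and "semibrick R \<X>"
    and "semisimple_over R \<X> M"
    and "semisimple_over R \<X> N"
    and "f \<in> lmod_hom R M N"
    and "\<exists>x\<in>carrier M. f x \<noteq> \<zero>\<^bsub>N\<^esub>"
  shows "semisimple_over R \<X> (lmod_kernel M N f) \<and> semisimple_over R \<X> (lmod_coker M N f)"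
proof
  interpret M: left_module R M using assms(3) by (simp add: semisimple_over_def)
  interpret N: left_module R N using assms(4) by (simp add: semisimple_over_def)
  note M = M.left_module_axioms and N = N.left_module_axioms and f = assms(5)
  obtain I :: "'m set" and F \<phi> where F: "\<And>i. i \<in> I \<Longrightarrow> F i \<in> \<X>"
    and \<phi>: "\<phi> \<in> lmod_hom R M (lmod_direct_sum I F)"
      "bij_betw \<phi> (carrier M) (carrier (lmod_direct_sum I F))"
    using assms(3) unfolding semisimple_over_def lmod_isomorphic_def by blast
  obtain J :: "'n set" and G \<psi> where G: "\<And>j. j \<in> J \<Longrightarrow> G j \<in> \<X>"
    and \<psi>: "\<psi> \<in> lmod_hom R N (lmod_direct_sum J G)"
      "bij_betw \<psi> (carrier N) (carrier (lmod_direct_sum J G))"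
    using assms(4) unfolding semisimple_over_def lmod_isomorphic_def by blast
  have brick: "brick R Y" if "Y \<in> \<X>" for Y using assms(2) that by (simp add: semibrick_def)
  note \<X>_module = brick_left_module[OF brick]
  \<comment> \<open>The summands of \<open>M\<close> and of \<open>N\<close> form one family, whose
    sum is a copy of the direct sum of \<open>M\<close> and \<open>N\<close>.\<close>
  define K where "K = I <+> J"
  define X where "X = case_sum F G"
  have X: "X k \<in> \<X>" if "k \<in> K" for k using that F G by (auto simp: K_def X_def)
  have X_inl: "F i = X (Inl i)" and X_inr: "G j = X (Inr j)" for i j by (auto simp: X_def)
  let ?MI = "lmod_direct_sum I F" and ?NJ = "lmod_direct_sum J G"
  note MI = left_module_direct_sum[OF assms(1) \<X>_module[OF F]]
  note NJ = left_module_direct_sum[OF assms(1) \<X>_module[OF G]]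
  define \<phi>' where "\<phi>' = inv_into (carrier M) \<phi>"
  define \<psi>' where "\<psi>' = inv_into (carrier N) \<psi>"
  have \<phi>': "\<phi>' \<in> lmod_hom R ?MI M" unfolding \<phi>'_def by (rule lmod_hom_inv_into[OF M \<phi>])
  have \<psi>': "\<psi>' \<in> lmod_hom R ?NJ N" unfolding \<psi>'_def by (rule lmod_hom_inv_into[OF N \<psi>])
  have \<phi>'\<phi>: "\<phi>' (\<phi> m) = m" if "m \<in> carrier M" for m
    unfolding \<phi>'_def by (rule bij_betw_inv_into_left[OF \<phi>(2) that])
  have \<psi>'\<psi>: "\<psi>' (\<psi> n) = n" if "n \<in> carrier N" for n
    unfolding \<psi>'_def by (rule bij_betw_inv_into_left[OF \<psi>(2) that])
  have \<phi>\<phi>': "\<phi> (\<phi>' x) = x" if "x \<in> carrier ?MI" for x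
    unfolding \<phi>'_def by (rule bij_betw_inv_into_right[OF \<phi>(2) that])
  let ?P = "lmod_direct_sum K X"
  have inl: "inj_on Inl I" "Inl ` I \<subseteq> K" and inr: "inj_on Inr J" "Inr ` J \<subseteq> K" by (auto simp: K_def)
  note pull_inl = direct_sum_pull_hom[where R=R and X=X, OF inl X_inl]
  note pull_inr = direct_sum_pull_hom[where R=R and X=X, OF inr X_inr]
  note push_inl = direct_sum_push_hom[where R=R and X=X, OF inl X_inl \<X>_module[OF X]]
  note push_inr = direct_sum_push_hom[where R=R and X=X, OF inr X_inr \<X>_module[OF X]]
  \<comment> \<open>In coordinates this is the map on the direct sum of \<open>M\<close> and
    \<open>N\<close> given by \<open>f\<close> on the first factor and the identity on the second.
    It is onto \<open>N\<close>, and its first block has the image of \<open>f\<close>.\<close>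
  define g where "g z = f (\<phi>' (direct_sum_pull I Inl z)) \<oplus>\<^bsub>N\<^esub> \<psi>' (direct_sum_pull J Inr z)" for z
  have g: "g \<in> lmod_hom R ?P N"
    unfolding g_def
    by (intro lmod_hom_plus N lmod_hom_compose[OF lmod_hom_compose[OF pull_inl \<phi>'] f]
        lmod_hom_compose[OF pull_inr \<psi>'])
  interpret schur_map R N K X J G "\<lambda>j y. \<psi> y j" g
  proof (intro schur_map.intro schur_map_axioms.intro N, goal_cases)
    case (1 k) then show ?case using \<X>_module[OF X] by simp
  next
    case (2 j) then show ?case using \<X>_module[OF G] by simp
  next
    case (3 k) then show ?case using brick_nontrivial[OF brick[OF X]] by simp
  next
    case (4 k j h x) then show ?case using semibrick_hom_bij[OF assms(2) X G] by blast
  next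
    case (5 j) then show ?case using lmod_hom_compose[OF \<psi>(1) direct_sum_component_hom] by blast
  next
    \<comment> \<open>The coordinates of \<open>\<psi>\<close> separate points because
      \<open>\<psi>\<close> is injective.\<close>
    case (6 y)
    have "\<psi> y = \<zero>\<^bsub>?NJ\<^esub>"
      using 6 lmod_hom_closed[OF \<psi>(1)] abelian_monoid.zero_closed[OF abelian_group.axioms(1)[OF left_module.axioms(2)[OF NJ]]]
      by (intro direct_sum_eqI[of _ J G]) (auto simp: direct_sum_zero)
    then show ?case using \<psi>'\<psi>[OF 6(1)] lmod_hom_zero[OF NJ N \<psi>'] by simp
  qed (rule g)

  have g_inl: "g z = f (\<phi>' (direct_sum_pull I Inl z))" if z: "z \<in> sub (Inl ` I)" for z
  proof -
    have zP: "z \<in> carrier ?P" using sub_closed[OF z] .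
    have "direct_sum_pull J Inr z = \<zero>\<^bsub>?NJ\<^esub>"
      using z inr by (auto simp: sub_def direct_sum_pull_def lmod_direct_sum_def X_inr fun_eq_iff)
    then show ?thesis
      using lmod_hom_zero[OF NJ N \<psi>'] lmod_hom_closed[OF lmod_hom_compose[OF lmod_hom_compose[OF pull_inl \<phi>'] f] zP]
      by (simp add: g_def)
  qed
  have push_sub: "direct_sum_push K X I Inl x \<in> sub (Inl ` I)" if "x \<in> carrier ?MI" for x
    using lmod_hom_closed[OF push_inl that] by (auto simp: sub_def direct_sum_push_apply_notin)
  have g_push: "g (direct_sum_push K X I Inl x) = f (\<phi>' x)" if "x \<in> carrier ?MI" for x
    using g_inl[OF push_sub[OF that]] direct_sum_pull_push[OF inl direct_sum_memD(1)[OF that], of X] by simp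
  have g_image: "g ` sub (Inl ` I) = f ` carrier M"
  proof
    show "g ` sub (Inl ` I) \<subseteq> f ` carrier M"
      using g_inl lmod_hom_closed[OF lmod_hom_compose[OF pull_inl \<phi>'] sub_closed] by auto
    show "f ` carrier M \<subseteq> g ` sub (Inl ` I)"
    proof (rule image_subsetI)
      fix m assume m: "m \<in> carrier M"
      note \<phi>m = lmod_hom_closed[OF \<phi>(1) m]
      have "g (direct_sum_push K X I Inl (\<phi> m)) = f m" using g_push[OF \<phi>m] \<phi>'\<phi>[OF m] by simp
      then show "f m \<in> g ` sub (Inl ` I)" using push_sub[OF \<phi>m] by (metis imageI)
    qed
  qed
  have g_surj: "y \<in> g ` sub K" if y: "y \<in> carrier N" for y
  proof -
    note \<psi>y = lmod_hom_closed[OF \<psi>(1) y]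
    let ?z = "direct_sum_push K X J Inr (\<psi> y)"
    have z: "?z \<in> carrier ?P" using lmod_hom_closed[OF push_inr \<psi>y] .
    have "direct_sum_pull I Inl ?z = \<zero>\<^bsub>?MI\<^esub>"
      using inl by (auto simp: direct_sum_pull_def lmod_direct_sum_def X_inl fun_eq_iff
          intro!: direct_sum_push_apply_notin)
    then have "f (\<phi>' (direct_sum_pull I Inl ?z)) = \<zero>\<^bsub>N\<^esub>"
      using lmod_hom_zero[OF MI N lmod_hom_compose[OF \<phi>' f]] by simp
    then have gz: "g ?z = y"
      using direct_sum_pull_push[OF inr direct_sum_memD(1)[OF \<psi>y], of X] \<psi>'\<psi>[OF y] y by (simp add: g_def)
    have "?z \<in> sub K" using z by (simp add: sub_def)
    then show ?thesis using imageI[of ?z "sub K" g] gz by simp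
  qed

  have "indep {}" by (auto simp: indep_def sub_empty)
  \<comment> \<open>\<open>T1\<close> uses only summands of \<open>M\<close> and is a basis of the
    image of \<open>f\<close>; \<open>T2\<close> prolongs it to a basis of \<open>N\<close>.\<close>
  then obtain T1 where T1: "T1 \<subseteq> Inl ` I" "indep T1" "g ` sub (Inl ` I) = g ` sub T1"
    using exists_basis_extension[OF empty_subsetI _ inl(2)] by metis
  obtain T2 where T2: "T1 \<subseteq> T2" "T2 \<subseteq> K" "indep T2" "g ` sub K = g ` sub T2"
    using exists_basis_extension[OF _ T1(2) subset_refl] T1(1) inl(2) by (metis subset_trans)

  show "semisimple_over R \<X> (lmod_kernel M N f)"
  proof (rule semisimple_overI)
    \<comment> \<open>The partial sum over \<open>T1\<close> corresponds to a complement of the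
      kernel in \<open>M\<close>, so projecting away from it identifies the kernel with the sum over
      the other indices.\<close>
    define S where "S = {i \<in> I. Inl i \<notin> T1}"
    have S: "inj_on id S" "id ` S \<subseteq> I" by (auto simp: S_def)
    have ker: "carrier (lmod_kernel M N f) = {m \<in> carrier M. f m = \<zero>\<^bsub>N\<^esub>}"
      by (auto simp: lmod_kernel_def a_kernel_def kernel_def)
    note Kf = left_module_kernel[OF M N f]
    show "left_module R (lmod_kernel M N f)" by (rule Kf)
    show "F i \<in> \<X>" if "i \<in> S" for i using that F by (simp add: S_def)
    then show SF: "left_module R (F i)" if "i \<in> S" for i using that \<X>_module by blast
    let ?\<kappa> = "\<lambda>m. direct_sum_pull S id (\<phi> m)"
    have FS: "F i = F (id i)" for i by simp
    have "?\<kappa> \<in> lmod_hom R M (lmod_direct_sum S F)"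
      using lmod_hom_compose[OF \<phi>(1) direct_sum_pull_hom[where R=R and X=F and Y=F and u=id, OF S FS]] .
    then have \<kappa>: "?\<kappa> \<in> lmod_hom R (lmod_kernel M N f) (lmod_direct_sum S F)"
      using ker by (auto simp: lmod_hom_def lmod_kernel_def)
    have "inj_on ?\<kappa> (carrier (lmod_kernel M N f))"
    proof (rule lmod_hom_inj_onI[OF Kf left_module_direct_sum[OF assms(1) SF] \<kappa>])
      fix m assume m: "m \<in> carrier (lmod_kernel M N f)" and z: "?\<kappa> m = \<zero>\<^bsub>lmod_direct_sum S F\<^esub>"
      then have mM: "m \<in> carrier M" "f m = \<zero>\<^bsub>N\<^esub>" by (auto simp: ker)
      note \<phi>m = lmod_hom_closed[OF \<phi>(1) mM(1)]
      \<comment> \<open>A kernel element whose coordinates in \<open>S\<close> vanish is supported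
        on \<open>T1\<close>, where \<open>g\<close> is injective.\<close>
      let ?z = "direct_sum_push K X I Inl (\<phi> m)"
      have "\<phi> m i = \<zero>\<^bsub>F i\<^esub>" if "i \<in> I" "Inl i \<notin> T1" for i
        using fun_cong[OF z, of i] that by (simp add: direct_sum_pull_def lmod_direct_sum_def S_def)
      then have "?z k = \<zero>\<^bsub>X k\<^esub>" if "k \<in> K - T1" for k
        using that direct_sum_push_apply[OF inl, of _ X "\<phi> m"] direct_sum_push_apply_notin[of k K Inl I X "\<phi> m"]
        by (cases "k \<in> Inl ` I") (auto simp: X_inl)
      then have "?z \<in> sub T1" using lmod_hom_closed[OF push_inl \<phi>m] by (simp add: sub_def)
      moreover have "g ?z = \<zero>\<^bsub>N\<^esub>" using g_push[OF \<phi>m] \<phi>'\<phi>[OF mM(1)] mM(2) by simp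
      ultimately have "?z = \<zero>\<^bsub>?P\<^esub>" using T1(2) by (simp add: indep_def)
      then have "\<phi> m = direct_sum_pull I Inl \<zero>\<^bsub>?P\<^esub>"
        using direct_sum_pull_push[OF inl direct_sum_memD(1)[OF \<phi>m], of X] by simp
      then have "\<phi> m = \<zero>\<^bsub>?MI\<^esub>" using lmod_hom_zero[OF P.left_module_axioms MI pull_inl] by simp
      then have "m = \<zero>\<^bsub>M\<^esub>" using \<phi>'\<phi>[OF mM(1)] lmod_hom_zero[OF MI M \<phi>'] by simp
      then show "m = \<zero>\<^bsub>lmod_kernel M N f\<^esub>" by (simp add: lmod_kernel_def)
    qed
    moreover have "?\<kappa> ` carrier (lmod_kernel M N f) = carrier (lmod_direct_sum S F)"
    proof
      show "?\<kappa> ` carrier (lmod_kernel M N f) \<subseteq> carrier (lmod_direct_sum S F)"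
        using lmod_hom_closed[OF \<kappa>] by blast
      show "carrier (lmod_direct_sum S F) \<subseteq> ?\<kappa> ` carrier (lmod_kernel M N f)"
      proof
        fix w assume w: "w \<in> carrier (lmod_direct_sum S F)"
        \<comment> \<open>Extend \<open>w\<close> by zero and subtract an element supported on
          \<open>T1\<close> with the same image under \<open>f\<close>. The difference lies in the
          kernel and still has the coordinates \<open>w\<close> on \<open>S\<close>.\<close>
        define x where "x = direct_sum_push I F S id w"
        have x: "x \<in> carrier ?MI"
          unfolding x_def
          by (rule lmod_hom_closed[OF direct_sum_push_hom[where R=R and X=F and Y=F and u=id,
                  OF S FS \<X>_module[OF F]] w])
        have "f (\<phi>' x) \<in> g ` sub T1"
          using g_push[OF x] push_sub[OF x] T1(3) by (metis imageI)
        then obtain t where t: "t \<in> sub T1" "f (\<phi>' x) = g t" by blast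
        define y where "y = direct_sum_pull I Inl t"
        have tI: "t \<in> sub (Inl ` I)" using t(1) sub_mono[OF T1(1)] by blast
        have y: "y \<in> carrier ?MI" unfolding y_def using lmod_hom_closed[OF pull_inl sub_closed[OF tI]] .
        have fxy: "f (\<phi>' x) = f (\<phi>' y)" using t(2) g_inl[OF tI] by (simp add: y_def)
        note \<phi>'c = lmod_hom_closed[OF \<phi>' x] lmod_hom_closed[OF \<phi>' y]
        define m where "m = \<phi>' x \<ominus>\<^bsub>M\<^esub> \<phi>' y"
        have mM: "m \<in> carrier M" using \<phi>'c by (simp add: m_def)
        have "f m = \<zero>\<^bsub>N\<^esub>"
          unfolding m_def using lmod_hom_diff[OF M N f \<phi>'c] fxy N.M.minus_self[OF lmod_hom_closed[OF f \<phi>'c(2)]]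
          by simp
        then have m: "m \<in> carrier (lmod_kernel M N f)" using mM by (simp add: ker)
        have \<phi>m: "\<phi> m = x \<ominus>\<^bsub>?MI\<^esub> y"
          unfolding m_def using lmod_hom_diff[OF M MI \<phi>(1) \<phi>'c] \<phi>\<phi>'[OF x] \<phi>\<phi>'[OF y] by simp
        have "?\<kappa> m = w"
        proof (rule direct_sum_eqI[OF lmod_hom_closed[OF \<kappa> m] w])
          fix i assume i: "i \<in> S"
          then have iI: "i \<in> I" by (simp add: S_def)
          interpret Fi: left_module R "F i" using SF[OF i] .
          have "\<phi> m i = x i \<ominus>\<^bsub>F i\<^esub> y i"
            unfolding \<phi>m using lmod_hom_diff[OF MI Fi.left_module_axioms direct_sum_component_hom[OF iI] x y] .
          moreover have "x i = w i" unfolding x_def using direct_sum_push_apply[OF S i, of F w] by simp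
          moreover have "y i = \<zero>\<^bsub>F i\<^esub>"
            using t(1) i iI inl(2) by (auto simp: y_def direct_sum_pull_def sub_def S_def X_inl)
          ultimately show "?\<kappa> m i = w i"
            using i direct_sum_memD(2)[OF w i] by (simp add: direct_sum_pull_def Fi.M.minus_eq)
        qed
        then show "w \<in> ?\<kappa> ` carrier (lmod_kernel M N f)" using m by blast
      qed
    qed
    ultimately show "lmod_isomorphic R (lmod_kernel M N f) (lmod_direct_sum S F)"
      using \<kappa> unfolding lmod_isomorphic_def bij_betw_def by blast
  qed

  show "semisimple_over R \<X> (lmod_coker M N f)"
  proof (rule semisimple_overI)
    \<comment> \<open>The indices added in the second extension span a complement of the image of
      \<open>f\<close> in \<open>N\<close>, which \<open>\<pi>\<close> maps isomorphically onto the
      cokernel.\<close>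
    define S where "S = T2 - T1"
    have S: "inj_on id S" "id ` S \<subseteq> K" using T2(2) by (auto simp: S_def)
    let ?C = "lmod_coker M N f" and ?S = "lmod_direct_sum S X"
    show Cf: "left_module R ?C" by (rule left_module_coker[OF M N f])
    show "X i \<in> \<X>" if "i \<in> S" for i using that X S by auto
    then show SX: "left_module R (X i)" if "i \<in> S" for i using that \<X>_module by blast
    have Smod: "left_module R ?S" by (rule left_module_direct_sum[OF assms(1) SX])
    interpret C: left_module R ?C by (rule Cf)
    define \<pi> where "\<pi> y = f ` carrier M +>\<^bsub>N\<^esub> y" for y
    have \<pi>: "\<pi> \<in> lmod_hom R N ?C" unfolding \<pi>_def by (rule lmod_coker_proj_hom[OF M N f])
    have \<pi>_surj: "\<pi> ` carrier N = carrier ?C" unfolding \<pi>_def by (rule lmod_coker_proj_surj[OF M N f])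
    have \<pi>_zero: "\<pi> y = \<zero>\<^bsub>?C\<^esub> \<longleftrightarrow> y \<in> g ` sub T1" if "y \<in> carrier N" for y
      unfolding \<pi>_def using lmod_coker_proj_eq_zero_iff[OF M N f that] g_image T1(3) by simp
    let ?e = "direct_sum_push K X S id"
    have XS: "X i = X (id i)" for i by simp
    have e: "?e \<in> lmod_hom R ?S ?P" by (rule direct_sum_push_hom[where R=R and X=X and Y=X and u=id, OF S XS \<X>_module[OF X]])
    have e_in: "?e x k = x k" if "k \<in> S" for x k
      using direct_sum_push_apply[OF S that, of X x] by simp
    have e_notin: "?e x k = \<zero>\<^bsub>X k\<^esub>" if "k \<in> K - S" for x k
      using direct_sum_push_apply_notin[of k K id S X x] that by simp
    have e_sub: "?e x \<in> sub T2" if "x \<in> carrier ?S" for x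
      using lmod_hom_closed[OF e that] e_notin by (auto simp: sub_def S_def)
    let ?c = "\<lambda>x. \<pi> (g (?e x))"
    have c: "?c \<in> lmod_hom R ?S ?C" by (rule lmod_hom_compose[OF lmod_hom_compose[OF e g] \<pi>])
    have "inj_on ?c (carrier ?S)"
    proof (rule lmod_hom_inj_onI[OF Smod Cf c])
      fix x assume x: "x \<in> carrier ?S" and cx: "?c x = \<zero>\<^bsub>?C\<^esub>"
      note ex = lmod_hom_closed[OF e x]
      \<comment> \<open>Vanishing in the cokernel means that \<open>g\<close> takes the same value
        at some \<open>t\<close> in \<open>sub T1\<close>. Independence of \<open>T2\<close>
        identifies the two arguments, and their supports lie in the disjoint sets \<open>S\<close>
        and \<open>T1\<close>.\<close>
      obtain t where t: "t \<in> sub T1" "g (?e x) = g t"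
        using cx \<pi>_zero[OF g_closed[OF ex]] by blast
      have "?e x \<ominus>\<^bsub>?P\<^esub> t \<in> sub T2" using sub_diff e_sub[OF x] t(1) sub_mono[OF T2(1)] by blast
      moreover have "g (?e x \<ominus>\<^bsub>?P\<^esub> t) = \<zero>\<^bsub>N\<^esub>"
        using lmod_hom_diff[OF P.left_module_axioms N g ex sub_closed[OF t(1)]] t(2)
          N.M.minus_self[OF g_closed[OF sub_closed[OF t(1)]]] by simp
      ultimately have "?e x \<ominus>\<^bsub>?P\<^esub> t = \<zero>\<^bsub>?P\<^esub>" using T2(3) by (simp add: indep_def)
      then have "?e x = t" using P.M.minus_eq_zeroD[OF ex sub_closed[OF t(1)]] by simp
      then have "x k = \<zero>\<^bsub>X k\<^esub>" if "k \<in> S" for k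
        using e_in[OF that, of x] t(1) that S by (auto simp: sub_def S_def)
      then show "x = \<zero>\<^bsub>?S\<^esub>"
        using x abelian_monoid.zero_closed[OF abelian_group.axioms(1)[OF left_module.axioms(2)[OF Smod]]]
        by (intro direct_sum_eqI[OF x]) (auto simp: direct_sum_zero)
    qed
    moreover have "?c ` carrier ?S = carrier ?C"
    proof
      show "?c ` carrier ?S \<subseteq> carrier ?C" using lmod_hom_closed[OF c] by blast
      show "carrier ?C \<subseteq> ?c ` carrier ?S"
      proof
        fix z assume "z \<in> carrier ?C"
        then obtain y where y: "y \<in> carrier N" "z = \<pi> y" using \<pi>_surj by blast
        then obtain t where t: "t \<in> sub T2" "y = g t" using g_surj T2(4) by blast
        note tP = sub_closed[OF t(1)]
        \<comment> \<open>Only the part of \<open>t\<close> on \<open>S\<close> is kept: the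
          remaining part is supported on \<open>T1\<close>, so its image under \<open>g\<close> lies
          in the image of \<open>f\<close> and dies in the cokernel.\<close>
        define x where "x = direct_sum_pull S id t"
        have x: "x \<in> carrier ?S"
          unfolding x_def by (rule lmod_hom_closed[OF direct_sum_pull_hom[where R=R and X=X and Y=X and u=id, OF S XS] tP])
        note ex = lmod_hom_closed[OF e x]
        have "(t \<ominus>\<^bsub>?P\<^esub> ?e x) k = \<zero>\<^bsub>X k\<^esub>" if k: "k \<in> K - T1" for k
        proof -
          interpret Xk: left_module R "X k" using \<X>_module[OF X] k by blast
          have "?e x k = t k"
            using e_in[of k x] e_notin[of k x] t(1) k
            by (cases "k \<in> S") (auto simp: x_def direct_sum_pull_def sub_def S_def)
          then show ?thesis
            using component_diff[OF _ tP ex, of k] k Xk.M.minus_self[OF direct_sum_memD(2)[OF tP]] by auto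
        qed
        then have "t \<ominus>\<^bsub>?P\<^esub> ?e x \<in> sub T1" using tP ex by (auto simp: sub_def)
        moreover have "g (t \<ominus>\<^bsub>?P\<^esub> ?e x) = y \<ominus>\<^bsub>N\<^esub> g (?e x)"
          using lmod_hom_diff[OF P.left_module_axioms N g tP ex] t(2) by simp
        ultimately have "y \<ominus>\<^bsub>N\<^esub> g (?e x) \<in> g ` sub T1" by (metis imageI)
        then have "\<pi> (y \<ominus>\<^bsub>N\<^esub> g (?e x)) = \<zero>\<^bsub>?C\<^esub>"
          using \<pi>_zero y(1) g_closed[OF ex] by simp
        then have "\<pi> y \<ominus>\<^bsub>?C\<^esub> ?c x = \<zero>\<^bsub>?C\<^esub>"
          using lmod_hom_diff[OF N Cf \<pi> y(1) g_closed[OF ex]] by simp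
        then have "z = ?c x"
          using C.M.minus_eq_zeroD lmod_hom_closed[OF \<pi> y(1)] lmod_hom_closed[OF c x] y(2) by blast
        then show "z \<in> ?c ` carrier ?S" using x by blast
      qed
    qed
    ultimately have "lmod_isomorphic R ?S ?C"
      using c unfolding lmod_isomorphic_def bij_betw_def by blast
    then show "lmod_isomorphic R ?C ?S" by (rule lmod_isomorphic_sym[OF Smod])
  qed
qed

end
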